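(* Let $G$ be a chordal graph with clique number $t\ge 2$. Let $p$ be a positive integer, let $S=\{p_1,p_2,\dots,p_s\}\subseteq\{1,2,\dots,p\}$ (with $s=|S|$), and let $q$ be the number of even integers in $S$. (a) If $1\notin S$, then $\chi\bigl(G^{[\natural p_1]}\cup G^{[\natural p_2]}\cup\dots\cup G^{[\natural p_s]}\bigr)\le \binom{t}{2}^{s}\cdot\Delta(G)^q\cdot(p+1)$. (b) If $1\in S$, then $\chi\bigl(G^{[\natural p_1]}\cup G^{[\natural p_2]}\cup\dots\cup G^{[\natural p_s]}\bigr)\le t\cdot\binom{t}{2}^{s-1}\cdot\Delta(G)^q\cdot(p+1)$.
   Context: All graphs are finite, simple, undirected and loopless. A graph is chordal if every induced cycle is a triangle. For a graph $G=(V,E)$ and a positive integer $p$, the exact distance-$p$ graph $G^{[\natural p]}$ has vertex set $V$, and $uv$ is an edge of $G^{[\natural p]}$ if and only if $d_G(u,v)=p$ ($d_G$ the shortest-path distance). For two graphs $G=(V,E)$ and $G'=(V,E')$ on the same vertex set, $G\cup G'=(V,E\cup E')$. $\Delta(G)$ denotes the maximum degree of $G$ and $\chi$ the chromatic number. *)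

theory Defs
  imports "Graph_Theory.Graph_Theory"
begin

text \<open>
  A finite simple undirected graph is a \<open>pair_graph\<close>: a finite, loop-free digraph whose arc
  relation is symmetric, so that an undirected edge \<open>uv\<close> is the pair of arcs \<open>(u, v)\<close>, \<open>(v, u)\<close>.
\<close>

text \<open>
  The library's \<open>cycle\<close> also admits the closed walk \<open>u, v, u\<close> along one undirected edge,
  hence the bound on the length. A cycle is induced if the subgraph of \<open>G\<close> induced by its
  vertices has no edges besides those of the cycle.
\<close>

definition induced_cycle :: "'a pair_pre_digraph \<Rightarrow> ('a \<times> 'a) awalk \<Rightarrow> bool" where
  "induced_cycle G c \<longleftrightarrow>
     pre_digraph.cycle (with_proj G) c \<and> length c \<ge> 3 \<and>
     arcs (with_proj G \<restriction> (fst ` set c)) = set c \<union> (set c)\<inverse>"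

definition chordal :: "'a pair_pre_digraph \<Rightarrow> bool" where
  "chordal G \<longleftrightarrow> (\<forall>c. induced_cycle G c \<longrightarrow> length c = 3)"

definition clique_number :: "'a pair_pre_digraph \<Rightarrow> nat" where
  "clique_number G = Max (card ` {K. K \<subseteq> pverts G \<and> pairwise (\<lambda>u v. (u, v) \<in> parcs G) K})"

definition max_degree :: "'a pair_pre_digraph \<Rightarrow> nat" where
  "max_degree G = Max (out_degree (with_proj G) ` pverts G)"

definition proper_colouring :: "'a pair_pre_digraph \<Rightarrow> nat \<Rightarrow> ('a \<Rightarrow> nat) \<Rightarrow> bool" where
  "proper_colouring G k f \<longleftrightarrow>
     f ` pverts G \<subseteq> {..<k} \<and> (\<forall>(u, v) \<in> parcs G. f u \<noteq> f v)"

definition chromatic_number :: "'a pair_pre_digraph \<Rightarrow> nat" where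
  "chromatic_number G = (LEAST k. \<exists>f. proper_colouring G k f)"

text \<open>
  The distance is the minimal cost of a walk when every arc has cost 1; it is \<open>\<infinity>\<close> between
  different components.
\<close>

definition graph_dist :: "'a pair_pre_digraph \<Rightarrow> 'a \<Rightarrow> 'a \<Rightarrow> ereal" where
  "graph_dist G u v = wf_digraph.\<mu> (with_proj G) (\<lambda>_. 1) u v"

definition exact_distance_graph :: "'a pair_pre_digraph \<Rightarrow> nat \<Rightarrow> 'a pair_pre_digraph" where
  "exact_distance_graph G p =
     \<lparr> pverts = pverts G,
       parcs = {(u, v). u \<in> pverts G \<and> v \<in> pverts G \<and> graph_dist G u v = ereal (real p)} \<rparr>"

text \<open>
  The union of the exact distance graphs for all distances in \<open>S\<close>. All of them have the vertex
  set of \<open>G\<close>, so the union is formed on that vertex set (also for empty \<open>S\<close>).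
\<close>

definition exact_distances_graph :: "'a pair_pre_digraph \<Rightarrow> nat set \<Rightarrow> 'a pair_pre_digraph" where
  "exact_distances_graph G S =
     \<lparr> pverts = pverts G, parcs = (\<Union>k\<in>S. parcs (exact_distance_graph G k)) \<rparr>"

end

theory Submission
  imports Defs
begin

text \<open>
  A chordal graph has an ordering of its vertices in which the older neighbours of each vertex form
  a clique. Let the level of a vertex be its number of steps along older neighbours to the root of
  its component. Adjacent vertices differ by at most one level, so colouring by the level modulo
  \<open>p + 1\<close> leaves only pairs on a common level. The key fact: if two vertices are connected by a walk
  all of whose levels exceed \<open>r\<close>, then all vertices of level \<open>r\<close> that either of them reaches by
  descending one level per step belong to one clique. Hence, if \<open>u\<close> and \<open>v\<close> lie on the same level
  at distance \<open>2m + 1\<close>, the sets that they reach in \<open>m\<close> descending steps are disjoint cliques joined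
  by an edge, and the oldest vertices of these two sets are at most two steps towards older vertices
  of the same level apart. As a level contains only cliques of size less than \<open>t\<close>, fewer than
  \<open>t choose 2\<close> vertices can be reached by such steps, so a greedy colouring separates the two. At
  distance \<open>2m\<close> the oldest vertices may also coincide; then \<open>u\<close> and \<open>v\<close> descend to their common
  oldest vertex through distinct neighbours of it, which costs the factor \<open>\<Delta>(G)\<close>.
\<close>

section \<open>Separating pairs by colourings\<close>

text \<open>Colouring relations rather than graphs allows different kinds of pairs on one vertex set
  to be coloured separately and the colourings to be combined.\<close>

definition separable :: "'a set \<Rightarrow> nat \<Rightarrow> ('a \<Rightarrow> 'a \<Rightarrow> bool) \<Rightarrow> bool" where
  "separable V n R \<longleftrightarrow>
     (\<exists>f :: 'a \<Rightarrow> nat. f ` V \<subseteq> {..<n} \<and> (\<forall>u\<in>V. \<forall>v\<in>V. R u v \<longrightarrow> f u \<noteq> f v))"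

lemma separableI:
  assumes "\<And>v. v \<in> V \<Longrightarrow> f v < n"
    and "\<And>u v. u \<in> V \<Longrightarrow> v \<in> V \<Longrightarrow> R u v \<Longrightarrow> f u \<noteq> f v"
  shows "separable V n R"
  unfolding separable_def using assms by (intro exI[of _ f]) auto

lemma separable_mono:
  assumes "separable V n R" "\<And>u v. u \<in> V \<Longrightarrow> v \<in> V \<Longrightarrow> Q u v \<Longrightarrow> R u v"
  shows "separable V n Q"
proof -
  obtain f where "f ` V \<subseteq> {..<n}" "\<forall>u\<in>V. \<forall>v\<in>V. R u v \<longrightarrow> f u \<noteq> f v"
    using assms(1) unfolding separable_def by metis
  then show ?thesis using assms(2) by (intro separableI[of _ f]) auto
qed

text \<open>The product colouring: the pair of colours of \<open>v\<close> is coded as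
  \<open>f v * m + g v\<close>, from which division by \<open>m\<close> recovers \<open>f v\<close>
  because \<open>g v < m\<close>.\<close>

lemma separable_mult:
  assumes "separable V n R" "separable V m Q"
  shows "separable V (n * m) (\<lambda>u v. R u v \<or> Q u v)"
proof -
  obtain f g where f: "f ` V \<subseteq> {..<n}" "\<forall>u\<in>V. \<forall>v\<in>V. R u v \<longrightarrow> f u \<noteq> f v"
    and g: "g ` V \<subseteq> {..<m}" "\<forall>u\<in>V. \<forall>v\<in>V. Q u v \<longrightarrow> g u \<noteq> g v"
    using assms unfolding separable_def by metis
  show ?thesis
  proof (rule separableI)
    show "f v * m + g v < n * m" if "v \<in> V" for v
    proof -
      have "Suc (f v) \<le> n" "g v < m" using that f(1) g(1) by auto
      then have "Suc (f v) * m \<le> n * m" by (intro mult_le_mono1)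
      then show ?thesis using \<open>g v < m\<close> by simp
    qed
    show "f u * m + g u \<noteq> f v * m + g v" if h: "u \<in> V" "v \<in> V" "R u v \<or> Q u v" for u v
    proof
      assume eq: "f u * m + g u = f v * m + g v"
      have lt: "g u < m" "g v < m" using h g(1) by auto
      have "(f u * m + g u) div m = f u" "(f v * m + g v) div m = f v" using lt by auto
      then have "f u = f v" using eq by simp
      then show False using eq f(2) g(2) h by auto
    qed
  qed
qed

lemma separable_prod:
  assumes "finite S" "\<And>k. k \<in> S \<Longrightarrow> separable V (n k) (R k)"
  shows "separable V (\<Prod>k\<in>S. n k) (\<lambda>u v. \<exists>k\<in>S. R k u v)"
  using assms
proof (induction S rule: finite_induct)
  case empty
  show ?case by (rule separableI[of _ "\<lambda>_. 0"]) auto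
next
  case (insert k S)
  then have "separable V (n k * (\<Prod>k\<in>S. n k)) (\<lambda>u v. R k u v \<or> (\<exists>k\<in>S. R k u v))"
    by (intro separable_mult) auto
  then show ?case using insert.hyps by simp
qed

lemma mod_eq_close:
  fixes a b n :: nat
  assumes "a mod n = b mod n" "a \<le> b" "b < a + n"
  shows "a = b"
proof -
  have "n dvd b - a" using assms(1,2) mod_eq_dvd_iff_nat[of a b n] by simp
  moreover have "b - a < n" using assms(2,3) by linarith
  ultimately have "b - a = 0" by (meson dvd_imp_le leD neq0_conv)
  then show ?thesis using assms(2) by simp
qed

section \<open>Layerings of simplicial orderings\<close>

text \<open>Smaller values of \<open>ord\<close> mean older vertices, so \<open>ord\<close> is a
  perfect elimination ordering read backwards.\<close>

locale simplicial_ordering =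
  fixes V :: "'a set" and E :: "'a \<Rightarrow> 'a \<Rightarrow> bool" and ord :: "'a \<Rightarrow> nat"
  assumes finite_V: "finite V"
    and E_sym: "E x y \<Longrightarrow> E y x"
    and E_irrefl: "\<not> E x x"
    and E_V: "E x y \<Longrightarrow> x \<in> V"
    and inj_ord: "inj_on ord V"
    and simplicial: "\<lbrakk>E v a; E v b; ord a < ord v; ord b < ord v; a \<noteq> b\<rbrakk> \<Longrightarrow> E a b"
begin

definition older :: "'a \<Rightarrow> 'a \<Rightarrow> bool" where
  "older v w \<longleftrightarrow> E v w \<and> ord w < ord v"

text \<open>A root is a vertex without older neighbours. Minimising over all roots avoids having to
  know that each component has only one, which follows only from
  \<open>root_unique_edge\<close>.\<close>

definition lev :: "'a \<Rightarrow> nat" where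
  "lev v = (LEAST n. \<exists>r. (older ^^ n) v r \<and> (\<forall>w. \<not> older r w))"

definition down :: "'a \<Rightarrow> 'a \<Rightarrow> bool" where
  "down v w \<longleftrightarrow> E v w \<and> lev v = Suc (lev w)"

lemma E_V2: "E x y \<Longrightarrow> y \<in> V"
  using E_V E_sym by blast

lemma E_ord: "E x y \<Longrightarrow> ord x < ord y \<or> ord y < ord x"
  by (metis E_V E_V2 E_irrefl inj_ord inj_on_def linorder_neqE_nat)

lemma E_older: "E x y \<Longrightarrow> older x y \<or> older y x"
  using E_ord E_sym by (auto simp: older_def)

lemma older_clique: "older v a \<Longrightarrow> older v b \<Longrightarrow> a = b \<or> E a b"
  using simplicial by (auto simp: older_def)

lemma ex_root: "\<exists>n r. (older ^^ n) v r \<and> (\<forall>w. \<not> older r w)"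
proof (induction "ord v" arbitrary: v rule: less_induct)
  case less
  show ?case
  proof (cases "\<exists>w. older v w")
    case True
    then obtain w where w: "older v w" by blast
    then obtain n r where "(older ^^ n) w r" "\<forall>w. \<not> older r w"
      using less[of w] by (auto simp: older_def)
    then show ?thesis using relpowp_Suc_I2[of older, OF w] by blast
  next
    case False
    then show ?thesis by (intro exI[of _ 0] exI[of _ v]) auto
  qed
qed

lemma lev_root: "\<exists>r. (older ^^ lev v) v r \<and> (\<forall>w. \<not> older r w)"
  unfolding lev_def by (rule LeastI_ex) (rule ex_root)

lemma lev_le: "(older ^^ n) v r \<Longrightarrow> \<forall>w. \<not> older r w \<Longrightarrow> lev v \<le> n"
  unfolding lev_def by (rule Least_le) blast

lemma lev_older_le: "older v w \<Longrightarrow> lev v \<le> Suc (lev w)"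
  using lev_root[of w] lev_le relpowp_Suc_I2[of older v w] by blast

lemma lev_pos_older:
  assumes "lev v > 0"
  shows "\<exists>w. older v w \<and> lev v = Suc (lev w)"
proof -
  obtain n where n: "lev v = Suc n" using assms gr0_conv_Suc by blast
  obtain r where r: "(older ^^ Suc n) v r" "\<forall>w. \<not> older r w" using lev_root[of v] n by auto
  obtain w where w: "older v w" "(older ^^ n) w r" using relpowp_Suc_D2[OF r(1)] by blast
  have "lev w \<le> n" using lev_le[OF w(2) r(2)] .
  moreover have "lev v \<le> Suc (lev w)" using lev_older_le[OF w(1)] .
  ultimately show ?thesis using w n by force
qed

lemma older_lev_pos: "older v w \<Longrightarrow> lev v > 0"
proof (rule ccontr)
  assume "older v w" "\<not> lev v > 0"
  then show False using lev_root[of v] by auto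
qed

text \<open>Let \<open>x\<close> follow \<open>v\<close> on a shortest chain to a root. Both
  \<open>x\<close> and \<open>w\<close> are older neighbours of \<open>v\<close>, hence equal or
  adjacent. If \<open>w\<close> is older than \<open>x\<close>, induction at \<open>x\<close>
  applies; if \<open>x\<close> is older, then \<open>w\<close> is at most one level above
  \<open>x\<close>, and that is the level of \<open>v\<close>.\<close>

lemma older_lev_mono: "older v w \<Longrightarrow> lev w \<le> lev v"
proof (induction "ord v" arbitrary: v w rule: less_induct)
  case less
  obtain x where x: "older v x" "lev v = Suc (lev x)"
    using lev_pos_older older_lev_pos less.prems by blast
  have ords: "ord x < ord v" "ord w < ord v" using x less.prems by (auto simp: older_def)
  from older_clique[OF x(1) less.prems]
  consider "x = w" | "older x w" | "older w x" using E_older by blast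
  then show ?case
  proof cases
    case 2
    then show ?thesis using less.hyps[OF ords(1)] x by force
  next
    case 3
    then show ?thesis using lev_older_le x by force
  qed (use x in auto)
qed

lemma E_lev: "E x y \<Longrightarrow> lev x \<le> Suc (lev y)"
  using E_older[of x y] lev_older_le[of x y] older_lev_mono[of y x] by force

lemma down_older: "down x y \<Longrightarrow> older x y"
  using E_older[of x y] older_lev_mono[of y x] by (force simp: down_def)

lemma lev_pos_down: "lev v > 0 \<Longrightarrow> \<exists>w. down v w"
  using lev_pos_older by (force simp: down_def older_def)

lemma down_exists: "n \<le> lev v \<Longrightarrow> \<exists>a. (down ^^ n) v a"
proof (induction n arbitrary: v)
  case (Suc n)
  then obtain w where w: "down v w" using lev_pos_down[of v] by auto
  moreover have "n \<le> lev w" using Suc.prems w by (auto simp: down_def)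
  ultimately show ?case using Suc.IH relpowp_Suc_I2 by metis
qed auto

lemma down_lev: "(down ^^ n) v a \<Longrightarrow> lev v = lev a + n"
proof (induction n arbitrary: v)
  case (Suc n)
  obtain w where w: "down v w" "(down ^^ n) w a" using relpowp_Suc_D2[OF Suc.prems] by blast
  show ?case using Suc.IH[OF w(2)] w(1) by (simp add: down_def)
qed auto

lemma down_E: "(down ^^ n) v a \<Longrightarrow> (E ^^ n) v a"
  by (rule relpowp_mono) (auto simp: down_def)

lemma relpowp_E_sym: "(E ^^ n) x y \<Longrightarrow> (E ^^ n) y x"
proof (induction n arbitrary: x)
  case (Suc n)
  then show ?case using relpowp_Suc_D2[OF Suc.prems] E_sym relpowp_Suc_I by metis
qed auto

lemma relpowp_E_V: "(E ^^ n) x y \<Longrightarrow> x \<in> V \<Longrightarrow> y \<in> V"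
  by (induction n arbitrary: y) (auto intro: E_V2)

lemma walk_lev: "(E ^^ n) x y \<Longrightarrow> lev x \<le> lev y + n"
proof (induction n arbitrary: x)
  case (Suc n)
  obtain z where z: "E x z" "(E ^^ n) z y" using relpowp_Suc_D2[OF Suc.prems] by blast
  show ?case using Suc.IH[OF z(2)] E_lev[OF z(1)] by linarith
qed auto

text \<open>An edge changes the level by at most one, so a walk that loses as many levels as it has
  steps descends at every step.\<close>

lemma walk_down:
  assumes "(E ^^ n) x y" "lev x = lev y + n"
  shows "(down ^^ n) x y"
  using assms
proof (induction n arbitrary: x)
  case (Suc n)
  obtain z where z: "E x z" "(E ^^ n) z y" using relpowp_Suc_D2[OF Suc.prems(1)] by blast
  have "lev z \<le> lev y + n" using walk_lev[OF z(2)] .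
  moreover have "lev x \<le> Suc (lev z)" using E_lev[OF z(1)] .
  ultimately have "down x z" "lev z = lev y + n" using Suc.prems(2) z by (auto simp: down_def)
  then show ?case using Suc.IH[OF z(2)] relpowp_Suc_I2 by metis
qed auto

section \<open>Walks above a level and the cliques below them\<close>

definition above :: "nat \<Rightarrow> 'a \<Rightarrow> 'a \<Rightarrow> bool" where
  "above r x y \<longleftrightarrow> E x y \<and> lev x > r \<and> lev y > r"

text \<open>Bounding \<open>ord\<close> lets facts about walks be proved by induction on the newest
  vertex that may occur.\<close>

definition above_upto :: "nat \<Rightarrow> nat \<Rightarrow> 'a \<Rightarrow> 'a \<Rightarrow> bool" where
  "above_upto r n x y \<longleftrightarrow> above r x y \<and> ord x < n \<and> ord y < n"

lemma above_upto_sym: "(above_upto r n)\<^sup>*\<^sup>* x y \<Longrightarrow> (above_upto r n)\<^sup>*\<^sup>* y x"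
proof (induction rule: rtranclp_induct)
  case (step y z)
  have "above_upto r n z y" using step(2) E_sym by (auto simp: above_upto_def above_def)
  then show ?case using step(3) by (rule converse_rtranclp_into_rtranclp)
qed auto

text \<open>A walk never needs its newest vertex in the interior, as the older neighbours form a clique.\<close>

lemma above_upto_Suc:
  assumes "(above_upto r (Suc n))\<^sup>*\<^sup>* u z" "ord u < n"
  shows "if ord z < n then (above_upto r n)\<^sup>*\<^sup>* u z
    else \<exists>x. older z x \<and> lev x > r \<and> (above_upto r n)\<^sup>*\<^sup>* u x"
  using assms
proof (induction rule: rtranclp_induct)
  case (step y z)
  have yz: "E y z" "lev y > r" "lev z > r" "ord y \<le> n" "ord z \<le> n"
    using step(2) by (auto simp: above_upto_def above_def)
  note IH = step.IH[OF step.prems]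
  consider "ord y < n" "ord z < n" | "ord y < n" "ord z = n" | "ord y = n" "ord z < n"
    using yz E_ord[OF yz(1)] by linarith
  then show ?case
  proof cases
    case 1
    then have "above_upto r n y z" using yz by (auto simp: above_upto_def above_def)
    then show ?thesis using IH 1 by auto
  next
    case 2
    then have "older z y" using yz E_sym by (auto simp: older_def)
    then show ?thesis using IH 2 yz by auto
  next
    case 3
    then have "older y z" using yz by (auto simp: older_def)
    \<comment> \<open>The walk leaves the newest vertex \<open>y\<close> towards \<open>z\<close>.
      The older neighbour \<open>x\<close> of \<open>y\<close>, already reached without
      \<open>y\<close>, is equal or adjacent to \<open>z\<close>, so \<open>y\<close> can be
      skipped.\<close>
    obtain x where x: "older y x" "lev x > r" "(above_upto r n)\<^sup>*\<^sup>* u x" using IH 3 by auto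
    have "x = z \<or> E x z" using older_clique[OF x(1) \<open>older y z\<close>] .
    moreover have "ord x < n" using x 3 by (auto simp: older_def)
    ultimately have "x = z \<or> above_upto r n x z" using 3 x yz by (auto simp: above_upto_def above_def)
    then show ?thesis using x(3) 3 by (auto intro: rtranclp.rtrancl_into_rtrancl)
  qed
qed auto

lemma above_upto_step:
  assumes "(above_upto r n)\<^sup>*\<^sup>* u x" "older v x" "lev x > r" "older v w" "lev w > r" "ord v = n"
  shows "(above_upto r n)\<^sup>*\<^sup>* u w"
proof (cases "x = w")
  case False
  then have "E x w" using older_clique assms by blast
  then have "above_upto r n x w" using assms by (auto simp: above_upto_def above_def older_def)
  then show ?thesis using assms(1) by auto
qed (use assms in auto)

text \<open>Induction on the order bound. An endpoint that is the newest admissible vertex is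
  replaced by an older vertex that still descends to the same vertex of level \<open>r\<close>; the
  walk survives because older neighbours form a clique.\<close>

lemma clique_below_upto:
  assumes "(above_upto r n)\<^sup>*\<^sup>* u v" "ord u < n" "ord v < n" "lev u = r + i" "lev v = r + j"
    "i > 0" "j > 0" "(down ^^ i) u a" "(down ^^ j) v b"
  shows "a = b \<or> E a b"
  using assms
proof (induction n arbitrary: u v a b i j)
  case (Suc n)
  have one: "a = b \<or> E a b"
    if h: "(above_upto r n)\<^sup>*\<^sup>* u x" "older v x" "lev x > r" "ord u < n" "ord v = n"
      "lev u = r + i" "lev v = r + j" "i > 0" "j > 0" "(down ^^ i) u a" "(down ^^ j) v b"
    for u v x a b i j
  proof -
    obtain j' where j': "j = Suc j'" using h gr0_conv_Suc by blast
    obtain w where w: "down v w" "(down ^^ j') w b" using relpowp_Suc_D2 h(11) j' by metis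
    have vw: "older v w" using down_older w by blast
    have lw: "lev w = r + j'" using w h j' by (auto simp: down_def)
    have xn: "ord x < n" "ord w < n" using h vw by (auto simp: older_def)
    show ?thesis
    proof (cases "j' = 0")
      \<comment> \<open>Here \<open>v\<close> is one level above \<open>b\<close>, so its first
        descending step already leaves the region above \<open>r\<close>. The endpoint moves to
        \<open>x\<close> instead, which must lie on level \<open>r + 1\<close> and is adjacent to
        \<open>b\<close>.\<close>
      case True
      then have "w = b" using w by auto
      have "lev x = Suc r" using older_lev_mono[OF h(2)] h(3,7) True j' by auto
      then have "E x b" using older_clique[OF h(2) vw] lw True \<open>w = b\<close> by auto
      then have "down x b" using \<open>lev x = Suc r\<close> lw True \<open>w = b\<close>
        by (simp add: down_def)
      then have "(down ^^ 1) x b" by (simp only: relpowp_1)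
      then show ?thesis using Suc.IH[of u x i 1 a b] h \<open>lev x = Suc r\<close> xn by auto
    next
      case False
      then have "(above_upto r n)\<^sup>*\<^sup>* u w" using above_upto_step[OF h(1,2,3) vw _ h(5)] lw by auto
      then show ?thesis using Suc.IH[of u w i j' a b] h False w xn lw by auto
    qed
  qed
  consider "ord u < n" "ord v < n" | "ord u < n" "ord v = n" | "ord u = n" "ord v < n"
    | "ord u = n" "ord v = n" using Suc.prems by linarith
  then show ?case
  proof cases
    case 1
    then show ?thesis using Suc.IH[of u v i j a b] above_upto_Suc[OF Suc.prems(1)] Suc.prems by auto
  next
    case 2
    then obtain x where "older v x" "lev x > r" "(above_upto r n)\<^sup>*\<^sup>* u x"
      using above_upto_Suc[OF Suc.prems(1)] by auto
    then show ?thesis using one[of u x v i j a b] 2 Suc.prems by auto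
  next
    case 3
    then obtain x where "older u x" "lev x > r" "(above_upto r n)\<^sup>*\<^sup>* v x"
      using above_upto_Suc[OF above_upto_sym[OF Suc.prems(1)]] by auto
    then show ?thesis using one[of v x u j i b a] 3 Suc.prems E_sym by auto
  next
    case 4
    have "u \<in> V" "v \<in> V"
      using relpowp_Suc_D2 Suc.prems(6-9) by (metis E_V down_def gr0_conv_Suc)+
    then have "u = v" using 4 inj_ord by (auto simp: inj_on_def)
    then have ij: "i = j" using Suc.prems by auto
    obtain j' where j': "j = Suc j'" using Suc.prems gr0_conv_Suc by blast
    obtain w where w: "down u w" "(down ^^ j') w a"
      using relpowp_Suc_D2[of j' down] Suc.prems(8) j' ij by metis
    obtain w' where w': "down u w'" "(down ^^ j') w' b"
      using relpowp_Suc_D2[of j' down] Suc.prems(9) j' \<open>u = v\<close> by metis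
    have ww: "older u w" "older u w'" using down_older w w' by blast+
    have lw: "lev w = r + j'" "lev w' = r + j'" using w w' Suc.prems ij j' by (auto simp: down_def)
    show ?thesis
    proof (cases "j' = 0")
      case True
      then show ?thesis using w w' older_clique[OF ww] by auto
    next
      case False
      then have "(above_upto r n)\<^sup>*\<^sup>* w w'" using above_upto_step[OF _ ww(1) _ ww(2) _ 4(1)] lw by auto
      moreover have "ord w < n" "ord w' < n" using ww 4 by (auto simp: older_def)
      ultimately show ?thesis using Suc.IH[of w w' j' j' a b] False w w' lw by auto
    qed
  qed
qed auto

lemma clique_below:
  assumes "(above r)\<^sup>*\<^sup>* u v" "lev u = r + i" "lev v = r + j"
    "i > 0" "j > 0" "(down ^^ i) u a" "(down ^^ j) v b"
  shows "a = b \<or> E a b"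
proof -
  \<comment> \<open>Any number above the orders of all vertices serves; \<open>ord u\<close> and
    \<open>ord v\<close> are added because \<open>u\<close> and \<open>v\<close> are not assumed to
    lie in \<open>V\<close>.\<close>
  define n where "n = Suc (ord u + ord v + (\<Sum>x\<in>V. ord x))"
  have ordn: "ord x < n" if "x \<in> V" for x
    using member_le_sum[of x V ord] that finite_V by (auto simp: n_def)
  have "above r \<le> above_upto r n"
    using ordn E_V E_V2 by (auto simp: above_upto_def above_def)
  then have "(above_upto r n)\<^sup>*\<^sup>* u v" using rtranclp_mono assms(1) by blast
  moreover have "ord u < n" "ord v < n" by (auto simp: n_def)
  ultimately show ?thesis using clique_below_upto assms by blast
qed

lemma down_clique:
  assumes "(down ^^ n) u a" "(down ^^ n) u b"
  shows "a = b \<or> E a b"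
proof (cases "n = 0")
  case False
  then show ?thesis using clique_below[of "lev a" u u n n a b] down_lev[OF assms(1)] assms by auto
qed (use assms in auto)

lemma walk_above_or_meets:
  assumes "(E ^^ n) u v" "lev u > r"
  shows "(above r)\<^sup>*\<^sup>* u v \<or> (\<exists>y i j. i + j = n \<and> (E ^^ i) u y \<and> (E ^^ j) y v \<and> lev y \<le> r)"
  using assms
proof (induction n arbitrary: u)
  case (Suc n)
  obtain z where z: "E u z" "(E ^^ n) z v" using relpowp_Suc_D2[OF Suc.prems(1)] by blast
  show ?case
  proof (cases "lev z > r")
    case True
    then have uz: "above r u z" using z Suc.prems by (auto simp: above_def)
    from Suc.IH[OF z(2) True] show ?thesis
    proof
      assume "(above r)\<^sup>*\<^sup>* z v"
      then show ?thesis using uz by (auto intro: converse_rtranclp_into_rtranclp)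
    next
      assume "\<exists>y i j. i + j = n \<and> (E ^^ i) z y \<and> (E ^^ j) y v \<and> lev y \<le> r"
      then obtain y i j where "i + j = n" "(E ^^ i) z y" "(E ^^ j) y v" "lev y \<le> r" by blast
      moreover have "(E ^^ Suc i) u y" using relpowp_Suc_I2[of E, OF z(1)] calculation(2) by blast
      ultimately have "Suc i + j = Suc n \<and> (E ^^ Suc i) u y \<and> (E ^^ j) y v \<and> lev y \<le> r" by simp
      then show ?thesis by blast
    qed
  next
    case False
    then have "1 + n = Suc n \<and> (E ^^ 1) u z \<and> (E ^^ n) z v \<and> lev z \<le> r" using z by auto
    then show ?thesis by blast
  qed
qed auto

text \<open>A walk that comes down to level \<open>r\<close> needs at least \<open>m\<close> steps
  on either side of the meeting point, hence exactly \<open>m\<close>, all of them descending. A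
  walk that stays above \<open>r\<close> is covered by \<open>clique_below\<close>.\<close>

lemma even_walk:
  assumes "(E ^^ (2*m)) u v" "lev u = r + m" "lev v = r + m" "m > 0"
  shows "(\<exists>y. (down ^^ m) u y \<and> (down ^^ m) v y) \<or>
    (\<forall>a b. (down ^^ m) u a \<longrightarrow> (down ^^ m) v b \<longrightarrow> a = b \<or> E a b)"
proof -
  have "lev u > r" using assms by auto
  from walk_above_or_meets[OF assms(1) this] show ?thesis
  proof
    assume "(above r)\<^sup>*\<^sup>* u v"
    then show ?thesis using clique_below assms by blast
  next
    assume "\<exists>y i j. i + j = 2*m \<and> (E ^^ i) u y \<and> (E ^^ j) y v \<and> lev y \<le> r"
    then obtain y i j where y: "i + j = 2*m" "(E ^^ i) u y" "(E ^^ j) v y" "lev y \<le> r"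
      using relpowp_E_sym by blast
    have "lev y = r" "i = m" "j = m" using walk_lev[OF y(2)] walk_lev[OF y(3)] y assms by auto
    then show ?thesis using walk_down y assms by metis
  qed
qed

lemma odd_walk:
  assumes "(E ^^ (2*m+1)) u v" "lev u = r + m" "lev v = r + m" "m > 0"
  shows "\<exists>a b. (down ^^ m) u a \<and> (down ^^ m) v b \<and> (a = b \<or> E a b)"
proof -
  \<comment> \<open>A walk meeting level \<open>r\<close> splits into \<open>m\<close> and
    \<open>m + 1\<close> steps, and the half of length \<open>m\<close> descends to
    \<open>y\<close>. On the other half, the neighbour \<open>z\<close> of \<open>y\<close> is
    either on level \<open>r\<close>, where \<open>v\<close> descends to it, or on level
    \<open>r + 1\<close>; then the remaining \<open>m\<close> steps are too few to touch level
    \<open>r\<close> again, and \<open>clique_below\<close> applies.\<close>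
  have key: "\<exists>a b. (down ^^ m) u a \<and> (down ^^ m) v b \<and> (a = b \<or> E a b)"
    if y: "(E ^^ m) u y" "(E ^^ Suc m) y v" "lev y = r" "lev u = r + m" "lev v = r + m" for u v y
  proof -
    obtain z where z: "E y z" "(E ^^ m) z v" using relpowp_Suc_D2[OF y(2)] by blast
    have uy: "(down ^^ m) u y" using walk_down y by auto
    have lz: "lev v \<le> lev z + m" using walk_lev[OF relpowp_E_sym[OF z(2)]] .
    show ?thesis
    proof (cases "lev z = r")
      case True
      then have "(down ^^ m) v z" using walk_down relpowp_E_sym[OF z(2)] y by auto
      then show ?thesis using z uy by blast
    next
      case False
      then have lz: "lev z = r + 1" using lz y E_lev[OF E_sym[OF z(1)]] by auto
      then have "lev z > r" by simp
      from walk_above_or_meets[OF z(2) this] show ?thesis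
      proof
        assume *: "(above r)\<^sup>*\<^sup>* z v"
        obtain b where b: "(down ^^ m) v b" using down_exists[of m v] y by auto
        have "down z y" using z E_sym lz y by (simp add: down_def)
        then have "(down ^^ 1) z y" by (simp only: relpowp_1)
        then have "y = b \<or> E y b" using clique_below[OF * lz, of m y b] y b assms(4) by auto
        then show ?thesis using uy b by blast
      next
        assume "\<exists>y i j. i + j = m \<and> (E ^^ i) z y \<and> (E ^^ j) y v \<and> lev y \<le> r"
        then obtain w i j where w: "i + j = m" "(E ^^ i) z w" "(E ^^ j) w v" "lev w \<le> r" by blast
        have "lev z \<le> lev w + i" "lev v \<le> lev w + j"
          using walk_lev w relpowp_E_sym by blast+
        then show ?thesis using w lz y by auto
      qed
    qed
  qed
  have "lev u > r" using assms by auto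
  from walk_above_or_meets[OF assms(1) this] show ?thesis
  proof
    assume "(above r)\<^sup>*\<^sup>* u v"
    then show ?thesis using clique_below down_exists[of m u] down_exists[of m v] assms
      by (metis le_add2)
  next
    assume "\<exists>y i j. i + j = 2*m+1 \<and> (E ^^ i) u y \<and> (E ^^ j) y v \<and> lev y \<le> r"
    then obtain y i j where y: "i + j = 2*m+1" "(E ^^ i) u y" "(E ^^ j) y v" "lev y \<le> r" by blast
    note y' = relpowp_E_sym[OF y(2)] relpowp_E_sym[OF y(3)]
    have l: "lev u \<le> lev y + i" "lev v \<le> lev y + j" using walk_lev y y' by blast+
    then have "lev y = r" using y assms by auto
    then consider "i = m" "j = Suc m" | "i = Suc m" "j = m" using l y(1) assms by linarith
    then show ?thesis
    proof cases
      case 1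
      then show ?thesis using key[of u y v] y \<open>lev y = r\<close> assms by auto
    next
      case 2
      then have "\<exists>a b. (down ^^ m) v a \<and> (down ^^ m) u b \<and> (a = b \<or> E a b)"
        using key[of v y u] y' \<open>lev y = r\<close> assms by auto
      then show ?thesis using E_sym by blast
    qed
  qed
qed

text \<open>The newer end of an edge has an older neighbour and so positive level. Hence level 0
  contains no edge, and a clique on it is a single vertex.\<close>

lemma root_unique_edge:
  assumes "E x y" "(down ^^ lev x) x a" "(down ^^ lev y) y b"
  shows "a = b"
proof -
  have la: "lev a = 0" "lev b = 0" using down_lev assms by fastforce+
  then have ne: "\<not> E a b" using E_older[of a b] older_lev_pos[of a b] older_lev_pos[of b a] by auto
  have unique: "a = b" if "older x y" "(down ^^ lev x) x a" "(down ^^ lev y) y b" "\<not> E a b"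
    for x y a b
  proof -
    have xp: "lev x > 0" using older_lev_pos that by blast
    show ?thesis
    proof (cases "lev x = lev y")
      case True
      then have "(above 0)\<^sup>*\<^sup>* x y" using xp that by (auto simp: above_def older_def)
      then show ?thesis using clique_below[of 0 x y] True xp that by auto
    next
      case False
      then have "lev x = Suc (lev y)" using lev_older_le[of x y] older_lev_mono[of x y] that by auto
      moreover then have "(down ^^ lev x) x b"
        using relpowp_Suc_I2[of down x y "lev y" b] that by (auto simp: down_def older_def)
      ultimately show ?thesis using down_clique that by blast
    qed
  qed
  show ?thesis using E_older[OF assms(1)] unique[of x y a b] unique[of y x b a] assms ne E_sym by blast
qed

text \<open>By \<open>root_unique_edge\<close> along the given walk, both ends descend to the same
  root; the two descents form the required walk.\<close>

lemma walk_le_lev: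
  assumes "(E ^^ n) x y"
  shows "(E ^^ (lev x + lev y)) x y"
proof -
  have "a = b" if "(down ^^ lev x) x a" "(down ^^ lev y) y b" "(E ^^ n) x y" for a b x n
    using that
  proof (induction n arbitrary: x a)
    case 0
    then show ?case using down_clique[of "lev x" x a b] down_lev E_older older_lev_pos
      by (metis add_cancel_right_left less_irrefl relpowp_0_E)
  next
    case (Suc n)
    obtain z where z: "E x z" "(E ^^ n) z y" using relpowp_Suc_D2[OF Suc.prems(3)] by blast
    obtain c where c: "(down ^^ lev z) z c" using down_exists by blast
    show ?case using root_unique_edge[OF z(1) Suc.prems(1) c] Suc.IH[OF c Suc.prems(2) z(2)] by simp
  qed
  moreover obtain a b where "(down ^^ lev x) x a" "(down ^^ lev y) y b"
    using down_exists by blast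
  ultimately show ?thesis using assms down_E relpowp_E_sym relpowp_trans by metis
qed

section \<open>Colouring the pairs on one level\<close>

text \<open>Vertices are coloured oldest first. At most one vertex has a given order, and since
  \<open>F w\<close> contains only vertices older than \<open>w\<close>, colouring it leaves the
  earlier constraints intact.\<close>

lemma greedy_colouring:
  assumes "\<And>v. v \<in> V \<Longrightarrow> card (F v) < n"
    and "\<And>v. v \<in> V \<Longrightarrow> finite (F v)"
    and "\<And>v x. x \<in> F v \<Longrightarrow> ord x < ord v"
  shows "\<exists>c :: 'a \<Rightarrow> nat. \<forall>v\<in>V. c v < n \<and> (\<forall>x\<in>F v. c x \<noteq> c v)"
proof -
  have "\<exists>c :: 'a \<Rightarrow> nat. \<forall>v\<in>V. ord v < k \<longrightarrow> c v < n \<and> (\<forall>x\<in>F v. c x \<noteq> c v)" for k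
  proof (induction k)
    case (Suc k)
    then obtain c :: "'a \<Rightarrow> nat"
      where c: "\<And>v. v \<in> V \<Longrightarrow> ord v < k \<Longrightarrow> c v < n \<and> (\<forall>x\<in>F v. c x \<noteq> c v)" by blast
    show ?case
    proof (cases "\<exists>v\<in>V. ord v = k")
      case True
      then obtain v where v: "v \<in> V" "ord v = k" by blast
      have unique: "w = v" if "w \<in> V" "ord w = k" for w
        using that v inj_ord by (auto simp: inj_on_def)
      have "card (c ` F v) < n"
        using card_image_le[of "F v" c] assms(1,2) v by (meson le_less_trans)
      then have "\<not> {..<n} \<subseteq> c ` F v"
        using card_mono[of "c ` F v" "{..<n}"] assms(2) v by auto
      then obtain i where i: "i < n" "i \<notin> c ` F v" by auto
      have "(c(v := i)) w < n \<and> (\<forall>x\<in>F w. (c(v := i)) x \<noteq> (c(v := i)) w)"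
        if w: "w \<in> V" "ord w < Suc k" for w
      proof (cases "w = v")
        case True
        then show ?thesis using i assms(3) by force
      next
        case False
        then have "ord w < k" using w unique less_Suc_eq by blast
        moreover have "v \<notin> F w" using assms(3)[of v w] v \<open>ord w < k\<close> by auto
        ultimately show ?thesis using c[OF w(1)] False by auto
      qed
      then show ?thesis by blast
    next
      case False
      then show ?thesis using c less_Suc_eq by (metis)
    qed
  qed auto
  from this[of "Suc (Max (ord ` V))"] show ?thesis
    using finite_V by (auto simp: less_Suc_eq_le)
qed

section \<open>Counting weakly reachable vertices on a level\<close>

definition peers :: "'a \<Rightarrow> 'a set" where
  "peers v = {w. older v w \<and> lev w = lev v}"

text \<open>Up to \<open>v\<close> itself, these are the vertices weakly 2-reachable from
  \<open>v\<close> within its level. Steps towards older vertices suffice, as a path through a newer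
  vertex has a shortcut between two of its older neighbours.\<close>

definition wreach :: "'a \<Rightarrow> 'a set" where
  "wreach v = peers v \<union> \<Union> (peers ` peers v)"

lemma peers_V: "peers v \<subseteq> V"
  using E_V2 by (auto simp: peers_def older_def)

lemma finite_peers: "finite (peers v)"
  using peers_V finite_V finite_subset by blast

lemma finite_wreach: "finite (wreach v)"
  using finite_peers by (simp add: wreach_def)

lemma wreach_ord: "x \<in> wreach v \<Longrightarrow> ord x < ord v"
  by (auto simp: wreach_def peers_def older_def)

text \<open>The newest vertex \<open>x\<close> of the clique \<open>Q\<close> has the other
  \<open>k\<close> members among its at most \<open>w\<close> peers, so it contributes only itself
  and at most \<open>w - k\<close> further vertices.\<close>

lemma card_clique_wreach:
  assumes "\<And>x. x \<in> V \<Longrightarrow> card (peers x) \<le> w"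
    and "Q \<subseteq> V" "\<And>x y. x \<in> Q \<Longrightarrow> y \<in> Q \<Longrightarrow> lev x = lev y \<and> (x = y \<or> E x y)"
  shows "card (Q \<union> \<Union> (peers ` Q)) \<le> card Q + (\<Sum>i<card Q. w - i)"
  using assms(2-3)
proof (induction "card Q" arbitrary: Q)
  case 0
  then have "Q = {}" using finite_V finite_subset by fastforce
  then show ?case by simp
next
  case (Suc k)
  have finQ: "finite Q" "Q \<noteq> {}" using Suc.hyps(2) by (auto intro: card_ge_0_finite)
  then have "Max (ord ` Q) \<in> ord ` Q" by (intro Max_in) auto
  then obtain x where "x \<in> Q" "Max (ord ` Q) = ord x" by blast
  then have x: "x \<in> Q" "\<And>y. y \<in> Q \<Longrightarrow> ord y \<le> ord x" using Max_ge[of "ord ` Q"] finQ by auto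
  define P where "P = Q - {x}"
  have P: "card P = k" "Q = insert x P" "x \<notin> P" "finite P" using x finQ Suc.hyps(2) by (auto simp: P_def)
  have IH: "card (P \<union> \<Union> (peers ` P)) \<le> card P + (\<Sum>i<card P. w - i)"
    by (rule Suc.hyps(1)) (use P Suc.prems in auto)
  have sub: "P \<subseteq> peers x"
  proof
    fix y assume "y \<in> P"
    then have y: "y \<in> Q" "y \<noteq> x" by (auto simp: P_def)
    then have "E x y" "lev y = lev x" using Suc.prems(2) x by blast+
    then show "y \<in> peers x" using E_ord[of x y] x(2)[OF y(1)] by (auto simp: peers_def older_def)
  qed
  have "card (peers x - P) = card (peers x) - card P"
    by (rule card_Diff_subset) (use sub P in auto)
  also have "\<dots> \<le> w - k" using assms(1)[of x] x Suc.prems P by auto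
  finally have d: "card (peers x - P) \<le> w - k" .
  have "Q \<union> \<Union> (peers ` Q) \<subseteq> insert x ((P \<union> \<Union> (peers ` P)) \<union> (peers x - P))"
    using P by auto
  then have "card (Q \<union> \<Union> (peers ` Q)) \<le> card (insert x ((P \<union> \<Union> (peers ` P)) \<union> (peers x - P)))"
    using finite_peers P by (intro card_mono) auto
  also have "\<dots> \<le> Suc (card ((P \<union> \<Union> (peers ` P)) \<union> (peers x - P)))" 
    using finite_peers P by (simp add: card_insert_if)
  also have "\<dots> \<le> Suc (card (P \<union> \<Union> (peers ` P)) + card (peers x - P))" using card_Un_le by auto
  also have "\<dots> \<le> Suc (k + (\<Sum>i<k. w - i) + (w - k))" using IH d P by simp
  finally show ?case using Suc.hyps(2)[symmetric] by simp
qed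

text \<open>The vertices reached in \<open>m\<close> descending steps form a clique, so its oldest
  member is an older neighbour of all the others.\<close>

definition apex :: "nat \<Rightarrow> 'a \<Rightarrow> 'a" where
  "apex m u = arg_min ord (\<lambda>a. (down ^^ m) u a)"

lemma
  assumes "m \<le> lev u"
  shows apex_down: "(down ^^ m) u (apex m u)"
    and apex_le: "(down ^^ m) u a \<Longrightarrow> ord (apex m u) \<le> ord a"
  using down_exists[OF assms] arg_min_nat_lemma[of "\<lambda>a. (down ^^ m) u a" _ ord]
  unfolding apex_def by blast+

lemma lev_apex: "m \<le> lev u \<Longrightarrow> lev (apex m u) = lev u - m"
  by (drule apex_down[THEN down_lev]) simp

lemma apex_V: "m \<le> lev u \<Longrightarrow> u \<in> V \<Longrightarrow> apex m u \<in> V"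
  using apex_down[of m u, THEN down_E] relpowp_E_V by blast

lemma E_wreach: "E x y \<Longrightarrow> lev x = lev y \<Longrightarrow> x \<in> wreach y \<or> y \<in> wreach x"
  using E_older[of x y] by (auto simp: wreach_def peers_def)

text \<open>Each apex is \<open>y\<close> or an older neighbour of \<open>y\<close>, and the older
  neighbours of \<open>y\<close> form a clique.\<close>

lemma apex_meet:
  assumes "m \<le> lev u" "m \<le> lev v" "(down ^^ m) u y" "(down ^^ m) v y"
  shows "apex m u = apex m v \<or> E (apex m u) (apex m v)"
proof -
  have "older y (apex m w) \<or> y = apex m w" if "m \<le> lev w" "(down ^^ m) w y" for w
    using down_clique[OF apex_down[OF that(1)] that(2)] apex_le[OF that] E_ord E_sym
    by (fastforce simp: older_def)
  then show ?thesis using older_clique assms E_sym by (metis older_def)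
qed

text \<open>
  If \<open>a\<close> is newer than \<open>b\<close>, then the apex of \<open>u\<close> and \<open>b\<close> are older neighbours of \<open>a\<close>, so the
  edge \<open>ab\<close> can be moved to the apex of \<open>u\<close>. From there the apex of \<open>v\<close> is at most one more step
  towards older vertices away.
\<close>

lemma apex_wreach:
  assumes "m \<le> lev u" "lev u = lev v"
    and disjoint: "\<And>a. (down ^^ m) u a \<Longrightarrow> \<not> (down ^^ m) v a"
    and "(down ^^ m) u a" "(down ^^ m) v b" "E a b"
  shows "apex m u \<in> wreach (apex m v) \<or> apex m v \<in> wreach (apex m u)"
proof -
  have one: "apex m u \<in> wreach (apex m v) \<or> apex m v \<in> wreach (apex m u)"
    if h: "m \<le> lev u" "lev u = lev v" "\<And>a. (down ^^ m) u a \<Longrightarrow> \<not> (down ^^ m) v a"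
      "(down ^^ m) u a" "(down ^^ m) v b" "older a b" for u v a b
  proof -
    let ?p = "apex m u" and ?q = "apex m v"
    have mv: "m \<le> lev v" using h by simp
    have levs: "lev a = lev u - m" "lev b = lev u - m" "lev ?p = lev u - m" "lev ?q = lev u - m"
      using lev_apex[of m u] lev_apex[of m v] h down_lev[OF h(4)] down_lev[OF h(5)] by auto
    have pb: "E ?p b"
    proof (cases "a = ?p")
      case False
      then have "older a ?p"
        using down_clique[OF apex_down[OF h(1)] h(4)] apex_le[OF h(1,4)] E_ord E_sym
        by (fastforce simp: older_def)
      moreover have "?p \<noteq> b" using h(3)[OF apex_down[OF h(1)]] h(5) by auto
      ultimately show ?thesis using older_clique[OF _ h(6)] by blast
    qed (use h(6) in \<open>simp add: older_def\<close>)
    show ?thesis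
    proof (cases "b = ?q")
      case True
      then show ?thesis using pb E_wreach levs by simp
    next
      case False
      then have bq: "older b ?q"
        using down_clique[OF apex_down[OF mv] h(5)] apex_le[OF mv h(5)] E_ord E_sym
        by (fastforce simp: older_def)
      then have bq': "?q \<in> peers b" using levs by (auto simp: peers_def)
      from E_older[OF pb] show ?thesis
      proof
        assume "older ?p b"
        then have "b \<in> peers ?p" using levs by (auto simp: peers_def)
        then show ?thesis using bq' by (auto simp: wreach_def)
      next
        assume "older b ?p"
        moreover have "?p \<noteq> ?q" using h(3)[OF apex_down[OF h(1)]] apex_down[OF mv] by auto
        ultimately have "E ?p ?q" using older_clique bq by blast
        then show ?thesis using E_wreach levs by simp
      qed
    qed
  qed
  show ?thesis
    using E_older[OF assms(6)] one[of u v a b] one[of v u b a] assms by (metis)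
qed

section \<open>Colouring pairs at an exact distance\<close>

definition exact :: "nat \<Rightarrow> 'a \<Rightarrow> 'a \<Rightarrow> bool" where
  "exact k u v \<longleftrightarrow> (E ^^ k) u v \<and> (\<forall>j<k. \<not> (E ^^ j) u v)"

text \<open>On a lower level, the descents to the common root would join \<open>u\<close> and
  \<open>v\<close> in fewer than \<open>k\<close> steps. Thus \<open>k div 2\<close> descending
  steps are always available.\<close>

lemma exact_le_lev:
  assumes "exact k u v" "lev u = lev v"
  shows "k div 2 \<le> lev u"
proof (rule ccontr)
  assume "\<not> k div 2 \<le> lev u"
  then have "lev u + lev v < k" using assms(2) by linarith
  then show False using walk_le_lev assms(1) by (auto simp: exact_def)
qed

context
  fixes t :: nat
  assumes clique_le: "\<And>K. K \<subseteq> V \<Longrightarrow> pairwise E K \<Longrightarrow> card K \<le> t" and t_ge: "t \<ge> 2"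
begin

lemma card_older:
  assumes "v \<in> V"
  shows "card {w. older v w} < t"
proof -
  have sub: "insert v {w. older v w} \<subseteq> V" using assms E_V2 by (auto simp: older_def)
  moreover have "pairwise E (insert v {w. older v w})"
    using older_clique E_sym by (auto simp: pairwise_def older_def)
  ultimately have "card (insert v {w. older v w}) \<le> t" by (rule clique_le)
  moreover have "v \<notin> {w. older v w}" by (auto simp: older_def)
  ultimately show ?thesis using finite_subset[OF sub finite_V] by simp
qed

text \<open>A neighbour one level up extends the clique of \<open>v\<close> and its peers.\<close>

lemma card_peers:
  assumes "v \<in> V"
  shows "card (peers v) \<le> t - 2"
proof (cases "lev v = 0")
  case True
  then have "peers v = {}" using older_lev_pos[of v] by (auto simp: peers_def)
  then show ?thesis by simp
next
  case False
  then obtain w where "older v w" "lev v = Suc (lev w)" using lev_pos_older by blast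
  then have "insert w (peers v) \<subseteq> {w. older v w}" "w \<notin> peers v" by (auto simp: peers_def)
  moreover have "finite {w. older v w}"
    by (rule finite_subset[OF _ finite_V]) (auto simp: older_def E_V2)
  ultimately have "Suc (card (peers v)) \<le> card {w. older v w}"
    using card_mono finite_peers by (metis card_insert_disjoint)
  then show ?thesis using card_older[OF assms] by simp
qed

text \<open>The clique \<open>peers v\<close> and the peer set of each of its members have size at
  most \<open>t - 2\<close>, so the count is at most
  \<open>(t - 2) + (1 + ... + (t - 2)) = (t choose 2) - 1\<close>.\<close>

lemma card_wreach:
  assumes "v \<in> V"
  shows "card (wreach v) < t choose 2"
proof -
  let ?w = "t - 2"
  have "card (wreach v) \<le> card (peers v) + (\<Sum>i<card (peers v). ?w - i)"
    unfolding wreach_def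
    by (rule card_clique_wreach[OF card_peers peers_V])
      (use older_clique[of v] in \<open>auto simp: peers_def\<close>)
  also have "\<dots> \<le> ?w + (\<Sum>i<?w. ?w - i)"
    using card_peers[OF assms] by (intro add_mono sum_mono2) auto
  also have "(\<Sum>i<?w. ?w - i) = (\<Sum>i<?w. Suc i)"
    using sum.nat_diff_reindex[of Suc ?w] by (simp add: Suc_diff_Suc)
  also have "w + (\<Sum>i<w. Suc i) < Suc (Suc w) choose 2" for w
    by (induction w) (simp_all add: numeral_2_eq_2)
  also have "Suc (Suc ?w) = t" using t_ge by simp
  finally show ?thesis .
qed

lemma separable_edges: "separable V t E"
proof -
  have "\<exists>c :: 'a \<Rightarrow> nat. \<forall>v\<in>V. c v < t \<and> (\<forall>x\<in>{w. older v w}. c x \<noteq> c v)"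
    by (rule greedy_colouring)
      (auto simp: card_older older_def E_V2 intro!: card_older[unfolded older_def] finite_subset[OF _ finite_V])
  then obtain c :: "'a \<Rightarrow> nat" where c: "\<And>v. v \<in> V \<Longrightarrow> c v < t"
    "\<And>v x. v \<in> V \<Longrightarrow> older v x \<Longrightarrow> c x \<noteq> c v" by auto
  show ?thesis
    by (rule separableI[of _ c]) (use c E_older in fastforce)+
qed

lemma wreach_colouring:
  "\<exists>c :: 'a \<Rightarrow> nat. \<forall>v\<in>V. c v < t choose 2 \<and> (\<forall>x\<in>wreach v. c x \<noteq> c v)"
  using card_wreach finite_wreach wreach_ord by (rule greedy_colouring)

lemma choose2_pos: "0 < t choose 2"
  using t_ge by (simp add: zero_less_binomial_iff)

lemma separable_odd:
  assumes "m > 0"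
  shows "separable V (t choose 2) (\<lambda>u v. lev u = lev v \<and> exact (2*m+1) u v)"
proof -
  obtain c :: "'a \<Rightarrow> nat" where c: "\<And>v. v \<in> V \<Longrightarrow> c v < t choose 2"
    "\<And>v x. v \<in> V \<Longrightarrow> x \<in> wreach v \<Longrightarrow> c x \<noteq> c v" using wreach_colouring by auto
  \<comment> \<open>The default 0 is never compared: by \<open>exact_le_lev\<close>, both vertices
    of a relevant pair have level at least \<open>m\<close>.\<close>
  define f where "f u = (if m \<le> lev u then c (apex m u) else 0)" for u
  show ?thesis
  proof (rule separableI[of _ f])
    show "f v < t choose 2" if "v \<in> V" for v using that c(1) apex_V choose2_pos by (auto simp: f_def)
    fix u v assume h: "u \<in> V" "v \<in> V" "lev u = lev v \<and> exact (2*m+1) u v"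
    have mu: "m \<le> lev u" "m \<le> lev v" using exact_le_lev[of "2*m+1" u v] h by auto
    have walk: "(E ^^ (2*m+1)) u v" using h by (simp only: exact_def)
    have lev_split: "lev u = lev u - m + m" "lev v = lev u - m + m" using h mu by auto
    \<comment> \<open>A common descendant would give a walk of length \<open>2*m\<close>, shorter
      than the distance.\<close>
    have disj: "\<not> (down ^^ m) v a" if "(down ^^ m) u a" for a
    proof
      assume "(down ^^ m) v a"
      then have "(E ^^ (m + m)) u v"
        using relpowp_trans[OF down_E[OF that] relpowp_E_sym[OF down_E]] by blast
      moreover have "m + m < 2*m+1" by simp
      ultimately show False using h by (auto simp: exact_def)
    qed
    obtain a b where ab: "(down ^^ m) u a" "(down ^^ m) v b" "a = b \<or> E a b"
      using odd_walk[of m u v "lev u - m", OF walk lev_split assms] by blast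
    then have "E a b" using disj by auto
    then have "apex m u \<in> wreach (apex m v) \<or> apex m v \<in> wreach (apex m u)"
      using apex_wreach[OF mu(1) _ disj ab(1,2)] h by auto
    then show "f u \<noteq> f v"
      using c(2)[OF apex_V[OF mu(1) h(1)]] c(2)[OF apex_V[OF mu(2) h(2)]] mu unfolding f_def by metis
  qed
qed

text \<open>Two colourings are multiplied. Distinct apexes are adjacent on one level, so a colouring
  for \<open>wreach\<close> separates them. If the apexes coincide, the vertices just before the
  apex on the two descents differ, and a numbering of its at most \<open>d\<close> neighbours
  separates these.\<close>

lemma separable_even:
  assumes "m > 0" "d > 0" "\<And>v. v \<in> V \<Longrightarrow> card {w. E v w} \<le> d"
  shows "separable V ((t choose 2) * d) (\<lambda>u v. lev u = lev v \<and> exact (2*m) u v)"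
proof -
  obtain n where n: "m = Suc n" using assms(1) gr0_conv_Suc by blast
  obtain c :: "'a \<Rightarrow> nat" where c: "\<And>v. v \<in> V \<Longrightarrow> c v < t choose 2"
    "\<And>v x. v \<in> V \<Longrightarrow> x \<in> wreach v \<Longrightarrow> c x \<noteq> c v" using wreach_colouring by auto
  have "\<exists>i :: 'a \<Rightarrow> nat. inj_on i {w. E v w} \<and> i ` {w. E v w} \<subseteq> {..<d}" if "v \<in> V" for v
  proof -
    have "finite {w. E v w}" by (rule finite_subset[OF _ finite_V]) (auto simp: E_V2)
    then obtain i :: "'a \<Rightarrow> nat" where "bij_betw i {w. E v w} {0..<card {w. E v w}}"
      using ex_bij_betw_finite_nat by blast
    then show ?thesis using assms(3)[OF that] by (intro exI[of _ i]) (auto simp: bij_betw_def)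
  qed
  then obtain i :: "'a \<Rightarrow> 'a \<Rightarrow> nat" where i: "\<And>v. v \<in> V \<Longrightarrow> inj_on (i v) {w. E v w}"
    "\<And>v w. v \<in> V \<Longrightarrow> E v w \<Longrightarrow> i v w < d" by (metis (mono_tags) image_subset_iff lessThan_iff mem_Collect_eq)
  have "\<exists>g. (down ^^ n) u g \<and> down g (apex m u)" if "m \<le> lev u" for u
    using apex_down[OF that] n by auto
  then obtain g where g: "\<And>u. m \<le> lev u \<Longrightarrow> (down ^^ n) u (g u) \<and> down (g u) (apex m u)" by metis
  have gE: "E (apex m u) (g u)" if "m \<le> lev u" for u using g[OF that] E_sym by (auto simp: down_def)
  have "separable V (t choose 2) (\<lambda>u v. lev u = lev v \<and> exact (2*m) u v \<and> apex m u \<noteq> apex m v)"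
  proof (rule separableI[of _ "\<lambda>u. if m \<le> lev u then c (apex m u) else 0"])
    show "(if m \<le> lev v then c (apex m v) else 0) < t choose 2" if "v \<in> V" for v
      using that c(1) apex_V choose2_pos by auto
    fix u v assume h: "u \<in> V" "v \<in> V" "lev u = lev v \<and> exact (2*m) u v \<and> apex m u \<noteq> apex m v"
    have mu: "m \<le> lev u" "m \<le> lev v" using exact_le_lev[of "2*m" u v] h by auto
    have walk: "(E ^^ (2*m)) u v" using h by (simp only: exact_def)
    have lev_split: "lev u = lev u - m + m" "lev v = lev u - m + m" using h mu by auto
    have "apex m u = apex m v \<or> E (apex m u) (apex m v)"
      using even_walk[of m u v "lev u - m", OF walk lev_split assms(1)]
        apex_meet[OF mu] apex_down[OF mu(1)] apex_down[OF mu(2)] by blast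
    then have "E (apex m u) (apex m v)" using h by simp
    then have "apex m u \<in> wreach (apex m v) \<or> apex m v \<in> wreach (apex m u)"
      using E_wreach lev_apex mu h by auto
    then show "(if m \<le> lev u then c (apex m u) else 0) \<noteq> (if m \<le> lev v then c (apex m v) else 0)"
      using c(2)[OF apex_V[OF mu(1) h(1)]] c(2)[OF apex_V[OF mu(2) h(2)]] mu by metis
  qed
  moreover have "separable V d (\<lambda>u v. lev u = lev v \<and> exact (2*m) u v \<and> apex m u = apex m v)"
  proof (rule separableI[of _ "\<lambda>u. if m \<le> lev u then i (apex m u) (g u) else 0"])
    show "(if m \<le> lev v then i (apex m v) (g v) else 0) < d" if "v \<in> V" for v
      using that i(2) gE apex_V assms(2) by auto
    fix u v assume h: "u \<in> V" "v \<in> V" "lev u = lev v \<and> exact (2*m) u v \<and> apex m u = apex m v"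
    have mu: "m \<le> lev u" "m \<le> lev v" using exact_le_lev[of "2*m" u v] h by auto
    \<comment> \<open>A common vertex before the apex would give a walk of length
      \<open>2 * (m - 1)\<close>.\<close>
    have "g u \<noteq> g v"
    proof
      assume "g u = g v"
      then have "(E ^^ (n + n)) u v"
        using relpowp_trans relpowp_E_sym down_E g[OF mu(1)] g[OF mu(2)] by metis
      moreover have "n + n < 2*m" using n by simp
      ultimately show False using h by (auto simp: exact_def)
    qed
    then show "(if m \<le> lev u then i (apex m u) (g u) else 0) \<noteq> (if m \<le> lev v then i (apex m v) (g v) else 0)"
      using i(1)[OF apex_V[OF mu(1) h(1)]] gE[OF mu(1)] gE[OF mu(2)] mu h
      by (auto simp: inj_on_def)
  qed
  ultimately show ?thesis by (rule separable_mono[OF separable_mult]) auto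
qed

end

lemma exact_1_E: "exact 1 u v \<Longrightarrow> E u v"
  by (simp only: exact_def relpowp_1)

lemma separable_exact:
  fixes t d :: nat and S :: "nat set"
  assumes clique: "\<And>K. K \<subseteq> V \<Longrightarrow> pairwise E K \<Longrightarrow> card K \<le> t" and "t \<ge> 2"
    and degree: "\<And>v. v \<in> V \<Longrightarrow> card {w. E v w} \<le> d" and "d > 0"
    and "S \<subseteq> {1..p}"
  defines "n \<equiv> \<lambda>k. if k = 1 then t else (t choose 2) * (if even k then d else 1)"
  shows "separable V ((\<Prod>k\<in>S. n k) * (p + 1)) (\<lambda>u v. \<exists>k\<in>S. exact k u v)"
proof -
  have S: "finite S" using assms(5) finite_subset by blast
  have "separable V (n k) (\<lambda>u v. lev u = lev v \<and> exact k u v)" if "k \<in> S" for k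
  proof -
    have "k \<ge> 1" using that assms(5) by auto
    then consider "k = 1" | "k = 2 * (k div 2)" "k div 2 > 0" | "k = 2 * (k div 2) + 1" "k div 2 > 0"
      by linarith
    then consider "k = 1" | m where "k = 2 * m" "m > 0" | m where "k = 2 * m + 1" "m > 0"
      by metis
    then show ?thesis
    proof cases
      case 1
      have "separable V t (\<lambda>u v. lev u = lev v \<and> exact k u v)"
        using clique \<open>t \<ge> 2\<close> 1 exact_1_E by (intro separable_mono[OF separable_edges]) auto
      then show ?thesis using 1 by (simp add: n_def)
    next
      case 2
      then show ?thesis
        using separable_even[OF clique \<open>t \<ge> 2\<close> _ \<open>d > 0\<close> degree, of m] by (simp add: n_def)
    next
      case 3
      then show ?thesis using separable_odd[OF clique \<open>t \<ge> 2\<close>, of m] by (simp add: n_def)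
    qed
  qed
  then have "separable V (\<Prod>k\<in>S. n k) (\<lambda>u v. \<exists>k\<in>S. lev u = lev v \<and> exact k u v)"
    using S by (intro separable_prod)
  moreover have "separable V (p + 1) (\<lambda>u v. lev u mod (p + 1) \<noteq> lev v mod (p + 1))"
    by (rule separableI[of _ "\<lambda>v. lev v mod (p + 1)"]) auto
  ultimately show ?thesis
  proof (rule separable_mono[OF separable_mult])
    fix u v assume "\<exists>k\<in>S. exact k u v"
    then obtain k where k: "k \<in> S" "exact k u v" by blast
    have "(E ^^ k) u v" using k by (simp add: exact_def)
    then have close: "lev u \<le> lev v + k" "lev v \<le> lev u + k" using walk_lev relpowp_E_sym by blast+
    have "k \<le> p" using k assms(5) by auto
    \<comment> \<open>The levels differ by at most \<open>k \<le> p\<close>, less than the modulus,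
      so equal residues force equal levels.\<close>
    have "lev u = lev v" if eq: "lev u mod (p + 1) = lev v mod (p + 1)"
      using mod_eq_close[OF eq] mod_eq_close[OF eq[symmetric]] close \<open>k \<le> p\<close> by linarith
    then show "(\<exists>k\<in>S. lev u = lev v \<and> exact k u v) \<or> lev u mod (p + 1) \<noteq> lev v mod (p + 1)"
      using k by blast
  qed
qed

end

section \<open>Simplicial orderings of chordal graphs\<close>

definition avoiding :: "('a \<Rightarrow> 'a \<Rightarrow> bool) \<Rightarrow> 'a \<Rightarrow> 'a \<Rightarrow> 'a \<Rightarrow> bool" where
  "avoiding E x a b \<longleftrightarrow> E a b \<and> a \<noteq> x \<and> b \<noteq> x \<and> \<not> E x a \<and> \<not> E x b"

text \<open>Chordality in terms of walks: neighbours of \<open>x\<close> joined through the outside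
  of its closed neighbourhood are adjacent. The conditions on \<open>c\<close> are separate because
  the walk from \<open>c\<close> to \<open>d\<close> may be empty.\<close>

locale hole_free =
  fixes E :: "'a \<Rightarrow> 'a \<Rightarrow> bool"
  assumes sym: "E x y \<Longrightarrow> E y x"
    and irrefl: "\<not> E x x"
    and no_hole: "\<lbrakk>E x y; E x z; y \<noteq> z; E y c; (avoiding E x)\<^sup>*\<^sup>* c d; E d z; c \<noteq> x; \<not> E x c\<rbrakk> \<Longrightarrow> E y z"
begin

definition simplicial_in :: "'a set \<Rightarrow> 'a \<Rightarrow> bool" where
  "simplicial_in W s \<longleftrightarrow> (\<forall>a\<in>W. \<forall>b\<in>W. E s a \<longrightarrow> E s b \<longrightarrow> a \<noteq> b \<longrightarrow> E a b)"

lemma clique_simplicial_in: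
  assumes "\<And>a b. a \<in> W \<Longrightarrow> b \<in> W \<Longrightarrow> a \<noteq> b \<Longrightarrow> E a b"
  shows "simplicial_in W s"
  using assms by (simp add: simplicial_in_def)

text \<open>
  The component \<open>C\<close> of \<open>y\<close> after deleting the closed neighbourhood of \<open>x\<close> attaches to the rest
  of \<open>W\<close> along a clique \<open>N\<close>, so a vertex of \<open>C\<close> that is simplicial in \<open>C \<union> N\<close> is simplicial in \<open>W\<close>.
\<close>

lemma ex_simplicial_nonadjacent:
  assumes "finite W" "x \<in> W" "y \<in> W" "y \<noteq> x" "\<not> E x y"
  shows "\<exists>s\<in>W. s \<noteq> x \<and> \<not> E x s \<and> simplicial_in W s"
  using assms
proof (induction "card W" arbitrary: W x y rule: less_induct)
  case less
  define R where "R = (\<lambda>a b. avoiding E x a b \<and> a \<in> W \<and> b \<in> W)"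
  define C where "C = {c. R\<^sup>*\<^sup>* y c}"
  define N where "N = {v\<in>W. E x v \<and> (\<exists>c\<in>C. E v c)}"
  have C: "c \<in> W \<and> c \<noteq> x \<and> \<not> E x c" if "c \<in> C" for c
  proof -
    have "R\<^sup>*\<^sup>* y c" using that by (simp add: C_def)
    then show ?thesis
      by (induction rule: rtranclp_induct) (use less.prems in \<open>auto simp: R_def avoiding_def\<close>)
  qed
  have R_sym: "R\<^sup>*\<^sup>* a b \<Longrightarrow> R\<^sup>*\<^sup>* b a" for a b
  proof (induction rule: rtranclp_induct)
    case (step b c)
    have "R c b" using step(2) sym by (auto simp: R_def avoiding_def)
    then show ?case using step(3) by (rule converse_rtranclp_into_rtranclp)
  qed auto
  have N_clique: "E a b" if ab: "a \<in> N" "b \<in> N" "a \<noteq> b" for a b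
  proof -
    obtain c d where cd: "c \<in> C" "E a c" "d \<in> C" "E b d" using ab by (auto simp: N_def)
    then have "R\<^sup>*\<^sup>* c d" using R_sym unfolding C_def by (metis mem_Collect_eq rtranclp_trans)
    moreover have "R \<le> avoiding E x" by (auto simp: R_def)
    ultimately have "(avoiding E x)\<^sup>*\<^sup>* c d" using rtranclp_mono by blast
    then show ?thesis using no_hole[of x a b c d] ab cd sym C by (auto simp: N_def)
  qed
  have nbrs: "d \<in> C \<union> N" if "c \<in> C" "E c d" "d \<in> W" for c d
  proof (cases "E x d")
    case True
    then show ?thesis using that sym by (auto simp: N_def)
  next
    case False
    then have "R c d" using that C[OF that(1)] sym by (auto simp: R_def avoiding_def)
    then show ?thesis using that(1) by (auto simp: C_def)
  qed
  have yC: "y \<in> C" by (simp add: C_def)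
  let ?goal = "\<exists>s\<in>W. s \<noteq> x \<and> \<not> E x s \<and> simplicial_in W s"
  let ?U = "C \<union> N"
  have U: "?U \<subseteq> W" "x \<notin> ?U" using C irrefl by (auto simp: N_def)
  have finU: "finite ?U" "finite C" using U less.prems(1) finite_subset by auto
  have "?U \<subset> W" "C \<subset> W" using U less.prems(2) by auto
  then have card: "card ?U < card W" "card C < card W" using less.prems(1) psubset_card_mono by blast+
  have lift: ?goal if s: "s \<in> C" "simplicial_in ?U s" for s
  proof -
    have "simplicial_in W s"
      using s nbrs unfolding simplicial_in_def by blast
    then show ?thesis using s(1) C[OF s(1)] by blast
  qed
  show ?case
  proof (cases "\<exists>a\<in>N. \<exists>b\<in>?U. b \<noteq> a \<and> \<not> E a b")
    \<comment> \<open>Induction on \<open>?U\<close> with the vertex \<open>a\<close> of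
      \<open>N\<close> gives a simplicial vertex not adjacent to \<open>a\<close>; as
      \<open>N\<close> is a clique, it lies in \<open>C\<close>. This is why the statement asks for
      non-adjacency to a prescribed vertex.\<close>
    case True
    then obtain a b where ab: "a \<in> N" "b \<in> ?U" "b \<noteq> a" "\<not> E a b" by blast
    then obtain s where s: "s \<in> ?U" "s \<noteq> a" "\<not> E a s" "simplicial_in ?U s"
      using less.hyps[OF card(1) finU(1), of a b] by auto
    then have "s \<in> C" using N_clique ab by blast
    then show ?thesis using lift s by blast
  next
    case universal: False
    \<comment> \<open>Now every vertex of \<open>N\<close> is adjacent to all other vertices of
      \<open>?U\<close>, so only pairs inside \<open>C\<close> matter.\<close>
    have liftC: ?goal if s: "s \<in> C" "simplicial_in C s" for s
    proof -
      have "simplicial_in ?U s"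
        unfolding simplicial_in_def
      proof (intro ballI impI)
        fix a b assume h: "a \<in> ?U" "b \<in> ?U" "E s a" "E s b" "a \<noteq> b"
        show "E a b"
        proof (cases "a \<in> N \<or> b \<in> N")
          case True
          then show ?thesis
          proof
            assume "a \<in> N"
            then show ?thesis using universal h(2,5) by metis
          next
            assume "b \<in> N"
            then have "E b a" using universal h(1,5) by metis
            then show ?thesis by (rule sym)
          qed
        next
          case False
          then show ?thesis using h s(2) by (auto simp: simplicial_in_def)
        qed
      qed
      then show ?thesis using lift s by blast
    qed
    show ?thesis
    proof (cases "\<exists>a\<in>C. \<exists>b\<in>C. b \<noteq> a \<and> \<not> E a b")
      case True
      then obtain a b where ab: "a \<in> C" "b \<in> C" "b \<noteq> a" "\<not> E a b" by blast
      then obtain s where "s \<in> C" "simplicial_in C s"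
        using less.hyps[OF card(2) finU(2) ab] by auto
      then show ?thesis by (rule liftC)
    next
      case False
      have "simplicial_in C y" by (rule clique_simplicial_in) (use False in metis)
      then show ?thesis using liftC yC by blast
    qed
  qed
qed

lemma ex_simplicial:
  assumes "finite W" "W \<noteq> {}"
  shows "\<exists>s\<in>W. simplicial_in W s"
proof (cases "\<exists>x\<in>W. \<exists>y\<in>W. y \<noteq> x \<and> \<not> E x y")
  case True
  then show ?thesis using ex_simplicial_nonadjacent[OF assms(1)] by blast
next
  case False
  obtain s where "s \<in> W" using assms(2) by blast
  moreover have "simplicial_in W s" by (rule clique_simplicial_in) (use False in metis)
  ultimately show ?thesis by blast
qed

lemma ex_simplicial_ordering:
  assumes "finite W"
  shows "\<exists>ord :: 'a \<Rightarrow> nat. inj_on ord W \<and> (\<forall>v\<in>W. simplicial_in {w\<in>W. ord w < ord v} v)"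
proof -
  \<comment> \<open>A simplicial vertex is removed and becomes the newest one; bounding the values
    by \<open>card W\<close> keeps the number \<open>n\<close> free for it.\<close>
  have "\<exists>ord :: 'a \<Rightarrow> nat. inj_on ord W \<and> ord ` W \<subseteq> {..<card W} \<and>
    (\<forall>v\<in>W. simplicial_in {w\<in>W. ord w < ord v} v)"
    using assms
  proof (induction "card W" arbitrary: W)
    case 0
    then have "W = {}" by simp
    then show ?case by simp
  next
    case (Suc n)
    then obtain s where s: "s \<in> W" "simplicial_in W s" using ex_simplicial[of W] by fastforce
    let ?X = "W - {s}"
    have n: "card ?X = n" "card W = Suc n" "finite ?X" using Suc s by auto
    obtain ord :: "'a \<Rightarrow> nat" where ord: "inj_on ord ?X" "\<And>v. v \<in> ?X \<Longrightarrow> ord v < n"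
      "\<And>v. v \<in> ?X \<Longrightarrow> simplicial_in {w\<in>?X. ord w < ord v} v"
      using Suc.hyps(1)[of ?X] n by auto
    define o' where "o' = ord(s := n)"
    have o': "o' s = n" "\<And>v. v \<in> ?X \<Longrightarrow> o' v = ord v" by (auto simp: o'_def)
    have "inj_on o' (insert s ?X)"
      unfolding inj_on_insert
    proof
      show "inj_on o' ?X" using ord(1) inj_on_cong[of ?X o' ord] o'(2) by blast
      show "o' s \<notin> o' ` (?X - {s})" using o' ord(2) by force
    qed
    then have "inj_on o' W" using s by (simp add: insert_absorb)
    moreover have "o' ` W \<subseteq> {..<card W}"
    proof
      fix i assume "i \<in> o' ` W"
      then obtain v where "v \<in> W" "i = o' v" by blast
      then show "i \<in> {..<card W}" using o' ord(2)[of v] n by (cases "v = s") auto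
    qed
    moreover have "simplicial_in {w\<in>W. o' w < o' v} v" if "v \<in> W" for v
    proof (cases "v = s")
      case True
      then show ?thesis using s by (auto simp: simplicial_in_def)
    next
      case False
      then have v: "v \<in> ?X" using that by simp
      then have "{w\<in>W. o' w < o' v} \<subseteq> {w\<in>?X. ord w < ord v}"
        using o' ord(2)[OF v] by (auto simp: o'_def split: if_splits)
      then show ?thesis using ord(3)[OF v] unfolding simplicial_in_def by blast
    qed
    ultimately show ?case by blast
  qed
  then show ?thesis by blast
qed

end

section \<open>From shortest bypasses to induced cycles\<close>

definition bypass :: "('a \<Rightarrow> 'a \<Rightarrow> bool) \<Rightarrow> 'a \<Rightarrow> nat \<Rightarrow> (nat \<Rightarrow> 'a) \<Rightarrow> bool" where
  "bypass E x n f \<longleftrightarrow> (\<forall>i<n. E (f i) (f (Suc i))) \<and> (\<forall>i. 0 < i \<and> i < n \<longrightarrow> f i \<noteq> x \<and> \<not> E x (f i))"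

text \<open>The chord cuts out the \<open>j - Suc i\<close> vertices strictly between its ends.
  Later indices shift by that amount, and the remaining interior still avoids \<open>x\<close> and
  its neighbours.\<close>

lemma bypass_shortcut:
  assumes f: "bypass E x n f" and ij: "Suc i < j" "j \<le> n" "E (f i) (f j)"
  shows "\<exists>m<n. \<exists>g. bypass E x m g \<and> g 0 = f 0 \<and> g m = f n"
proof -
  define k where "k = j - Suc i"
  define g where "g l = (if l \<le> i then f l else f (l + k))" for l
  have k: "k > 0" "Suc i + k = j" using ij by (auto simp: k_def)
  have "bypass E x (n - k) g"
    unfolding bypass_def
  proof (intro conjI allI impI)
    show "E (g l) (g (Suc l))" if "l < n - k" for l
    proof -
      consider "l < i" | "l = i" | "l > i" by linarith
      then show ?thesis
      proof cases
        case 1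
        then show ?thesis using f ij by (auto simp: g_def bypass_def)
      next
        case 2
        then show ?thesis using ij k by (auto simp: g_def)
      next
        case 3
        then show ?thesis using f that by (auto simp: g_def bypass_def)
      qed
    qed
    show "g l \<noteq> x" "\<not> E x (g l)" if l: "0 < l \<and> l < n - k" for l
    proof -
      define l' where "l' = (if l \<le> i then l else l + k)"
      have "0 < l' \<and> l' < n" "g l = f l'" using l by (auto simp: g_def l'_def)
      then show "g l \<noteq> x" "\<not> E x (g l)" using f by (auto simp: bypass_def)
    qed
  qed
  moreover have "g 0 = f 0" "g (n - k) = f n" "n - k < n" using ij k by (auto simp: g_def)
  ultimately show ?thesis by blast
qed

lemma pcas_map:
  "pcas (h 0) (map (\<lambda>i. (h i, h (Suc i))) [0..<n]) (h n)"
proof (induction n arbitrary: h)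
  case (Suc n)
  show ?case using Suc[of "h \<circ> Suc"] by (simp add: upt_conv_Cons map_Suc_upt[symmetric] del: upt_Suc) (simp add: comp_def)
qed simp

lemma pawalk_verts_map:
  "pawalk_verts (h 0) (map (\<lambda>i. (h i, h (Suc i))) [0..<n]) = map h [0..<Suc n]"
proof (induction n arbitrary: h)
  case (Suc n)
  show ?case using Suc[of "h \<circ> Suc"] by (simp add: upt_conv_Cons map_Suc_upt[symmetric] del: upt_Suc) (simp add: comp_def)
qed simp

text \<open>A shortest bypass of \<open>x\<close> has no chords, so together with \<open>x\<close> it is an induced cycle.\<close>

lemma chordal_hole_free:
  assumes "pair_graph G" "chordal G"
  shows "hole_free (\<lambda>u v. (u, v) \<in> parcs G)"
proof
  interpret pair_graph G by fact
  let ?E = "\<lambda>u v. (u, v) \<in> parcs G"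
  show sym: "?E v u" if "?E u v" for u v using that by (rule arcs_symmetric)
  show irrefl: "\<not> ?E v v" for v using no_loops' by auto
  fix x y z c d
  assume h: "?E x y" "?E x z" "y \<noteq> z" "?E y c" "(avoiding ?E x)\<^sup>*\<^sup>* c d" "?E d z" "c \<noteq> x" "\<not> ?E x c"
  show "?E y z"
  proof (rule ccontr)
    assume nyz: "\<not> ?E y z"
    define P where "P n \<longleftrightarrow> (\<exists>f. bypass ?E x n f \<and> f 0 = y \<and> f n = z)" for n
    obtain n f where f: "f 0 = c" "f n = d" "\<And>i. i < n \<Longrightarrow> avoiding ?E x (f i) (f (Suc i))"
      using h(5) rtranclp_imp_relpowp[of "avoiding ?E x" c d] by (auto simp: relpowp_fun_conv)
    \<comment> \<open>The walk from \<open>c\<close> to \<open>d\<close>, with \<open>y\<close> put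
      in front and \<open>z\<close> at the end, is a bypass of length \<open>n + 2\<close>.\<close>
    define g where "g i = (if i = 0 then y else if i \<le> Suc n then f (i - 1) else z)" for i
    have avoid: "f i \<noteq> x \<and> \<not> ?E x (f i)" if "i \<le> n" for i
      using that f(1) f(3)[of "i - 1"] h(7,8) by (cases i) (auto simp: avoiding_def)
    have step: "?E (g i) (g (Suc i))" if "i < Suc (Suc n)" for i
    proof -
      consider "i = 0" | j where "i = Suc j" "j < n" | "i = Suc n"
        using \<open>i < Suc (Suc n)\<close> by (cases i) (auto simp: less_Suc_eq)
      then show ?thesis
        by cases (use h f(1,2) f(3) in \<open>auto simp: g_def avoiding_def\<close>)
    qed
    have "g i \<noteq> x \<and> \<not> ?E x (g i)" if "0 < i \<and> i < Suc (Suc n)" for i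
    proof -
      have "i - 1 \<le> n" using that by linarith
      then show ?thesis using avoid that by (simp add: g_def)
    qed
    then have "bypass ?E x (Suc (Suc n)) g" unfolding bypass_def using step by blast
    then have "P (Suc (Suc n))" unfolding P_def by (intro exI[of _ g]) (auto simp: g_def)
    then have "\<exists>n. P n \<and> (\<forall>m<n. \<not> P m)" using exists_least_iff[of P] by blast
    then obtain n where n: "P n" "\<And>m. m < n \<Longrightarrow> \<not> P m" by blast
    then obtain f where f: "bypass ?E x n f" "f 0 = y" "f n = z" unfolding P_def by blast
    have chordless: "\<not> ?E (f i) (f j)" if "Suc i < j" "j \<le> n" for i j
      using bypass_shortcut[OF f(1) that] n(2) f(2,3) unfolding P_def by metis
    have edge: "?E (f i) (f (Suc i))" if "i < n" for i using f(1) that by (auto simp: bypass_def)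
    have n2: "2 \<le> n"
    proof (rule ccontr)
      assume "\<not> 2 \<le> n"
      then consider "n = 0" | "n = 1" by linarith
      then show False by cases (use f edge[of 0] h(3) nyz in auto)
    qed
    \<comment> \<open>A repeated vertex would yield a chord: the edge leaving its second occurrence
      or, when that is the final \<open>z\<close>, the edge entering the first one, which is not the
      start because \<open>y \<noteq> z\<close>.\<close>
    have inj: "f i \<noteq> f j" if "i < j" "j \<le> n" for i j
    proof
      assume eq: "f i = f j"
      show False
      proof (cases "j = n")
        case True
        have "i \<noteq> 0" using True eq f(2,3) h(3) by (metis)
        then have "?E (f (i - 1)) (f j)" using edge[of "i - 1"] that eq by simp
        then show False using chordless[of "i - 1" j] that \<open>i \<noteq> 0\<close> by simp
      next
        case False
        then have "?E (f i) (f (Suc j))" using edge[of j] that eq by simp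
        then show False using chordless[of i "Suc j"] that False by simp
      qed
    qed
    have x_adj: "f i \<noteq> x \<and> (?E x (f i) \<longleftrightarrow> i = 0 \<or> i = n)" if "i \<le> n" for i
    proof (cases "i = 0 \<or> i = n")
      case True
      then show ?thesis using f(2,3) h(1,2) irrefl by auto
    next
      case False
      then show ?thesis using that f(1) by (auto simp: bypass_def)
    qed
    \<comment> \<open>\<open>k\<close> runs through \<open>x\<close>, \<open>f 0\<close>, ...,
      \<open>f n\<close>, \<open>x\<close>, a closed sequence with \<open>l = n + 2\<close>
      arcs.\<close>
    define l where "l = Suc (Suc n)"
    define k where "k i = (if i = 0 \<or> i = l then x else f (i - 1))" for i
    define p where "p = map (\<lambda>i. (k i, k (Suc i))) [0..<l]"
    have k_simps: "k 0 = x" "k l = x" "\<And>i. i \<le> n \<Longrightarrow> k (Suc i) = f i" by (auto simp: k_def l_def)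
    have k_step: "?E (k i) (k (Suc i))" if i: "i < l" for i
    proof -
      consider "i = 0" | j where "i = Suc j" "j < n" | "i = Suc n"
        using i by (cases i) (auto simp: l_def less_Suc_eq)
      then show ?thesis
        using x_adj[of 0] x_adj[of n] sym edge k_simps by cases (auto simp: l_def)
    qed
    have set_p: "set p = {(k i, k (Suc i)) |i. i < l}" by (auto simp: p_def)
    have fst_p: "fst ` set p = insert x (f ` {..n})"
    proof -
      have "fst ` set p = k ` {..<l}" by (force simp: set_p)
      also have "{..<l} = insert 0 (Suc ` {..n})" 
        unfolding l_def lessThan_Suc_atMost by (rule atMost_Suc_eq_insert_0)
      finally show ?thesis using k_simps(1,3) by (auto simp: image_image)
    qed
    have "awalk x p x"
    proof -
      have "x \<in> pverts G" using h(1) by (rule in_arcsD1)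
      moreover have "pcas x p x" using pcas_map[of k l] k_simps by (simp add: p_def)
      moreover have "set p \<subseteq> parcs G" using k_step by (auto simp: set_p)
      ultimately show ?thesis by (simp add: awalk_def)
    qed
    moreover have "distinct (tl (pawalk_verts x p))"
    proof -
      have "pawalk_verts x p = map k [0..<Suc l]" using pawalk_verts_map[of k l] k_simps by (simp add: p_def)
      also have "tl \<dots> = map (\<lambda>i. k (Suc i)) [0..<l]"
        by (simp add: upt_conv_Cons map_Suc_upt[symmetric] del: upt_Suc)
      also have "distinct \<dots>"
      proof -
        have "inj_on (\<lambda>i. k (Suc i)) {0..<l}"
        proof (rule linorder_inj_onI)
          fix i j assume ij: "i < j" "i \<in> {0..<l}" "j \<in> {0..<l}"
          show "k (Suc i) \<noteq> k (Suc j)"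
          proof (cases "j = Suc n")
            case True
            then show ?thesis using ij k_simps x_adj[of i] by (auto simp: l_def)
          next
            case False
            then show ?thesis using ij k_simps inj[of i j] by (auto simp: l_def)
          qed
        qed auto
        then show ?thesis by (simp add: distinct_map)
      qed
      finally show ?thesis .
    qed
    moreover have "p \<noteq> []" by (simp add: p_def l_def)
    ultimately have cycle: "cycle p" unfolding cycle_def by blast
    \<comment> \<open>The cycle is induced: \<open>x\<close> is adjacent only to \<open>f 0\<close>
      and \<open>f n\<close>, and the bypass has no chords.\<close>
    have k_edges: "?E a b \<Longrightarrow> a \<in> insert x (f ` {..n}) \<Longrightarrow> b \<in> insert x (f ` {..n}) \<Longrightarrow>
        (a, b) \<in> set p \<union> (set p)\<inverse>" for a b
    proof -
      assume ab: "?E a b" "a \<in> insert x (f ` {..n})" "b \<in> insert x (f ` {..n})"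
      have in_p: "(k i, k (Suc i)) \<in> set p" if "i < l" for i using that by (auto simp: set_p)
      have first: "(x, y) \<in> set p" using in_p[of 0] k_simps f by (auto simp: l_def)
      have last: "(z, x) \<in> set p" using in_p[of "Suc n"] k_simps f by (auto simp: l_def)
      have mid: "(f i, f (Suc i)) \<in> set p" if "i < n" for i
        using in_p[of "Suc i"] k_simps(3)[of i] k_simps(3)[of "Suc i"] that by (simp add: l_def)
      have x_edge: "(x, v) \<in> set p \<union> (set p)\<inverse>" if "?E x v" "v \<in> f ` {..n}" for v
        using that x_adj first last f(2,3) by auto
      consider "a = x" "b = x" | "a = x" "b \<in> f ` {..n}" | "b = x" "a \<in> f ` {..n}"
        | i j where "a = f i" "b = f j" "i \<le> n" "j \<le> n" using ab by auto
      then show "(a, b) \<in> set p \<union> (set p)\<inverse>"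
      proof cases
        case 1
        then show ?thesis using ab irrefl by simp
      next
        case 2
        then show ?thesis using ab x_edge by simp
      next
        case 3
        then show ?thesis using ab x_edge[of a] sym by auto
      next
        case 4
        then consider "j = Suc i" | "i = Suc j"
          using ab(1) chordless[of i j] chordless[of j i] sym irrefl
          by (metis Suc_lessI linorder_neqE_nat)
        then show ?thesis using mid 4 by cases auto
      qed
    qed
    have p_sub: "set p \<union> (set p)\<inverse> \<subseteq> parcs G \<inter> fst ` set p \<times> fst ` set p"
    proof -
      have "k i \<in> fst ` set p" if "i \<le> l" for i
      proof (cases "i = l")
        case True
        then show ?thesis using k_simps by (auto simp: fst_p)
      next
        case False
        then show ?thesis using that by (force simp: set_p)
      qed
      then show ?thesis using k_step sym by (auto simp: set_p)
    qed
    have "{e \<in> parcs G. fst e \<in> fst ` set p \<and> snd e \<in> fst ` set p} = set p \<union> (set p)\<inverse>"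
      (is "?L = ?R")
    proof (rule equalityI)
      show "?L \<subseteq> ?R" using k_edges unfolding fst_p by (intro subsetI) (metis (mono_tags) mem_Collect_eq prod.collapse)
      show "?R \<subseteq> ?L"
      proof
        fix e assume "e \<in> ?R"
        then have "e \<in> parcs G \<inter> fst ` set p \<times> fst ` set p" by (rule subsetD[OF p_sub])
        then show "e \<in> ?L" by (simp add: mem_Times_iff)
      qed
    qed
    then have "arcs (with_proj G \<restriction> (fst ` set p)) = set p \<union> (set p)\<inverse>"
      by (simp add: induce_subgraph_def)
    moreover have "length p = l" by (simp add: p_def)
    ultimately have "induced_cycle G p" using cycle n2 unfolding induced_cycle_def by (simp add: l_def)
    then have "length p = 3" using assms(2) unfolding chordal_def by blast
    \<comment> \<open>As \<open>n \<ge> 2\<close>, the cycle has length at least 4.\<close>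
    then show False using n2 \<open>length p = l\<close> by (simp add: l_def)
  qed
qed

section \<open>Distances and the bound\<close>

context pair_graph
begin

lemma card_clique_le:
  assumes "K \<subseteq> pverts G" "pairwise (\<lambda>u v. (u, v) \<in> parcs G) K"
  shows "card K \<le> clique_number G"
  unfolding clique_number_def using assms pair_finite_verts by (intro Max_ge) auto

lemma ex_max_clique:
  "\<exists>K \<subseteq> pverts G. pairwise (\<lambda>u v. (u, v) \<in> parcs G) K \<and> card K = clique_number G"
proof -
  let ?A = "card ` {K. K \<subseteq> pverts G \<and> pairwise (\<lambda>u v. (u, v) \<in> parcs G) K}"
  have "{} \<in> {K. K \<subseteq> pverts G \<and> pairwise (\<lambda>u v. (u, v) \<in> parcs G) K}" by simp
  then have "?A \<noteq> {}" by blast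
  then have "Max ?A \<in> ?A" using pair_finite_verts by (intro Max_in) auto
  then show ?thesis unfolding clique_number_def by auto
qed

lemma card_nbrs_le:
  assumes "v \<in> pverts G"
  shows "card {w. (v, w) \<in> parcs G} \<le> max_degree G"
proof -
  have "out_arcs (with_proj G) v = Pair v ` {w. (v, w) \<in> parcs G}" by (auto simp: out_arcs_def)
  then have "card {w. (v, w) \<in> parcs G} = out_degree (with_proj G) v"
    by (simp add: out_degree_def card_image inj_on_def)
  also have "\<dots> \<le> max_degree G"
    unfolding max_degree_def using assms pair_finite_verts by (intro Max_ge) auto
  finally show ?thesis .
qed

lemma max_degree_pos:
  assumes "clique_number G \<ge> 2"
  shows "max_degree G > 0"
proof -
  obtain K where K: "K \<subseteq> pverts G" "pairwise (\<lambda>u v. (u, v) \<in> parcs G) K" "card K \<ge> 2"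
    using ex_max_clique assms by auto
  obtain u where u: "u \<in> K" using K(3) by fastforce
  have "\<not> K \<subseteq> {u}" using K(3) card_mono[of "{u}" K] by auto
  then obtain v where "v \<in> K" "v \<noteq> u" by blast
  then have "(u, v) \<in> parcs G" using K(2) u by (auto simp: pairwise_def)
  moreover have "finite {w. (u, w) \<in> parcs G}"
    by (rule finite_subset[OF _ pair_finite_verts]) (auto dest: in_arcsD2)
  ultimately have "card {w. (u, w) \<in> parcs G} > 0" by (auto simp: card_gt_0_iff)
  then show ?thesis using card_nbrs_le[of u] u K(1) by fastforce
qed

lemma awalk_relpowp:
  assumes "u \<in> pverts G"
  shows "(\<exists>p. awalk u p v \<and> length p = n) \<longleftrightarrow> ((\<lambda>a b. (a, b) \<in> parcs G) ^^ n) u v"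
  using assms
proof (induction n arbitrary: u)
  case 0
  then show ?case by (auto simp: awalk_Nil_iff)
next
  case (Suc n)
  have "(\<exists>p. awalk u p v \<and> length p = Suc n) \<longleftrightarrow>
      (\<exists>w. (u, w) \<in> parcs G \<and> (\<exists>p. awalk w p v \<and> length p = n))"
  proof
    assume "\<exists>p. awalk u p v \<and> length p = Suc n"
    then obtain e p where "awalk u (e # p) v" "length p = n" by (auto simp: length_Suc_conv)
    then show "\<exists>w. (u, w) \<in> parcs G \<and> (\<exists>p. awalk w p v \<and> length p = n)"
      by (intro exI[of _ "snd e"]) (auto simp: awalk_Cons_iff)
  next
    assume "\<exists>w. (u, w) \<in> parcs G \<and> (\<exists>p. awalk w p v \<and> length p = n)"
    then obtain w p where "(u, w) \<in> parcs G" "awalk w p v" "length p = n" by blast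
    then show "\<exists>p. awalk u p v \<and> length p = Suc n"
      by (intro exI[of _ "(u, w) # p"]) (auto simp: awalk_Cons_iff)
  qed
  also have "\<dots> \<longleftrightarrow> (\<exists>w. (u, w) \<in> parcs G \<and> ((\<lambda>a b. (a, b) \<in> parcs G) ^^ n) w v)"
    using Suc.IH in_arcsD2 by blast
  also have "\<dots> \<longleftrightarrow> ((\<lambda>a b. (a, b) \<in> parcs G) ^^ Suc n) u v"
    unfolding relpowp_Suc_left by (auto simp: relcompp_apply)
  finally show ?case .
qed

lemma awalk_cost_length: "awalk_cost (\<lambda>_. 1) p = real (length p)"
  by (induction p) auto

lemma graph_dist_eqD:
  assumes "u \<in> pverts G" "graph_dist G u v = ereal (real k)"
  shows "((\<lambda>a b. (a, b) \<in> parcs G) ^^ k) u v"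
    and "j < k \<Longrightarrow> \<not> ((\<lambda>a b. (a, b) \<in> parcs G) ^^ j) u v"
proof -
  have mu: "\<mu> (\<lambda>_. 1) u v = ereal (real k)" using assms(2) by (simp add: graph_dist_def)
  have ge: "k \<le> length p" if "awalk u p v" for p
    using min_cost_le_walk_cost[OF that, of "\<lambda>_. 1"] mu by (simp add: awalk_cost_length)
  \<comment> \<open>The infimum lies below \<open>k + 1\<close>, so some walk is shorter than
    \<open>k + 1\<close>; as no walk is shorter than \<open>k\<close>, its length is
    \<open>k\<close>.\<close>
  have "(INF p\<in>{p. awalk u p v}. ereal (awalk_cost (\<lambda>_. 1) p)) < ereal (real k + 1)"
    using mu unfolding \<mu>_def by simp
  then obtain p where "awalk u p v" "real (length p) < real k + 1"
    by (auto simp: INF_less_iff awalk_cost_length)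
  then have "awalk u p v \<and> length p = k" using ge[of p] by auto
  then show "((\<lambda>a b. (a, b) \<in> parcs G) ^^ k) u v" using awalk_relpowp[OF assms(1)] by blast
  show "\<not> ((\<lambda>a b. (a, b) \<in> parcs G) ^^ j) u v" if "j < k"
    using that ge awalk_relpowp[OF assms(1), of v j] by fastforce
qed

end

section \<open>Bounding the chromatic number of the union\<close>

lemma chromatic_number_le:
  fixes G :: "'a pair_pre_digraph"
  assumes "separable (pverts G) n (\<lambda>u v. (u, v) \<in> parcs G)"
    and "\<And>u v. (u, v) \<in> parcs G \<Longrightarrow> u \<in> pverts G \<and> v \<in> pverts G"
  shows "chromatic_number G \<le> n"
proof -
  obtain f :: "'a \<Rightarrow> nat" where "f ` pverts G \<subseteq> {..<n}"
    "\<forall>u\<in>pverts G. \<forall>v\<in>pverts G. (u, v) \<in> parcs G \<longrightarrow> f u \<noteq> f v"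
    using assms(1) unfolding separable_def by metis
  then have "proper_colouring G n f"
    using assms(2) by (auto simp: proper_colouring_def)
  then have "\<exists>f. proper_colouring G n f" by blast
  then show ?thesis unfolding chromatic_number_def by (rule Least_le)
qed

lemma prod_if_even:
  fixes a d :: nat
  assumes "finite S"
  shows "(\<Prod>k\<in>S. a * (if even k then d else 1)) = a ^ card S * d ^ card {k\<in>S. even k}"
  using assms by (simp add: prod.distrib prod.inter_filter[symmetric])

lemma chromatic_number_exact_distances:
  assumes "pair_graph G" "chordal G" "clique_number G \<ge> 2" "S \<subseteq> {1..p}"
  shows "chromatic_number (exact_distances_graph G S) \<le>
    (\<Prod>k\<in>S. if k = 1 then clique_number G
      else (clique_number G choose 2) * (if even k then max_degree G else 1)) * (p + 1)"
proof -
  interpret pair_graph G by fact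
  let ?E = "\<lambda>u v. (u, v) \<in> parcs G"
  interpret hole_free ?E using assms by (intro chordal_hole_free)
  obtain ord :: "'a \<Rightarrow> nat" where ord: "inj_on ord (pverts G)"
    "\<And>v. v \<in> pverts G \<Longrightarrow> simplicial_in {w\<in>pverts G. ord w < ord v} v"
    using ex_simplicial_ordering[OF pair_finite_verts] by blast
  interpret simplicial_ordering "pverts G" ?E ord
  proof
    show "(a, b) \<in> parcs G"
      if "(v, a) \<in> parcs G" "(v, b) \<in> parcs G" "ord a < ord v" "ord b < ord v" "a \<noteq> b" for v a b
      using ord(2)[of v] that in_arcsD1[of v a] in_arcsD2[of v a] in_arcsD2[of v b]
      unfolding simplicial_in_def by blast
  qed (use ord(1) pair_finite_verts sym irrefl in_arcsD1 in auto)
  show ?thesis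
  proof (rule chromatic_number_le)
    show "u \<in> pverts (exact_distances_graph G S) \<and> v \<in> pverts (exact_distances_graph G S)"
      if "(u, v) \<in> parcs (exact_distances_graph G S)" for u v
      using that by (auto simp: exact_distances_graph_def exact_distance_graph_def)
    show "separable (pverts (exact_distances_graph G S)) ((\<Prod>k\<in>S. if k = 1 then clique_number G
        else (clique_number G choose 2) * (if even k then max_degree G else 1)) * (p + 1))
      (\<lambda>u v. (u, v) \<in> parcs (exact_distances_graph G S))"
    proof (rule separable_mono)
      show "separable (pverts (exact_distances_graph G S)) ((\<Prod>k\<in>S. if k = 1 then clique_number G
          else (clique_number G choose 2) * (if even k then max_degree G else 1)) * (p + 1))
        (\<lambda>u v. \<exists>k\<in>S. exact k u v)"
        using separable_exact[OF card_clique_le assms(3) card_nbrs_le max_degree_pos[OF assms(3)] assms(4)]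
        by (simp add: exact_distances_graph_def)
      show "\<exists>k\<in>S. exact k u v" if uv: "(u, v) \<in> parcs (exact_distances_graph G S)" for u v
      proof -
        obtain k where "k \<in> S" "u \<in> pverts G" "graph_dist G u v = ereal (real k)"
          using uv by (auto simp: exact_distances_graph_def exact_distance_graph_def)
        then show ?thesis using graph_dist_eqD[of u v k] unfolding exact_def by blast
      qed
    qed
  qed
qed

theorem theorem1p5:
  fixes G :: "'a pair_pre_digraph" and t p s q :: nat and S :: "nat set"
  assumes "pair_graph G"
    and "chordal G"
    and "clique_number G = t" and "t \<ge> 2"
    and "p \<ge> 1"
    and "S \<subseteq> {1..p}"
    and "s = card S"
    and "q = card {k \<in> S. even k}"
  shows "(1 \<notin> S \<longrightarrow>
           chromatic_number (exact_distances_graph G S)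
             \<le> (t choose 2) ^ s * max_degree G ^ q * (p + 1)) \<and>
         (1 \<in> S \<longrightarrow>
           chromatic_number (exact_distances_graph G S)
             \<le> t * (t choose 2) ^ (s - 1) * max_degree G ^ q * (p + 1))"
proof -
  define n where "n k = (if k = 1 then t else (t choose 2) * (if even k then max_degree G else 1))"
    for k :: nat
  have bound: "chromatic_number (exact_distances_graph G S) \<le> (\<Prod>k\<in>S. n k) * (p + 1)"
    using chromatic_number_exact_distances[OF assms(1,2) _ assms(6)] assms(4)
    unfolding n_def assms(3)[symmetric] by blast
  have S: "finite S" using assms(6) finite_subset by blast
  have rest: "(\<Prod>k\<in>S - {1}. n k) = (t choose 2) ^ card (S - {1}) * max_degree G ^ q"
  proof -
    have "(\<Prod>k\<in>S - {1}. n k) = (\<Prod>k\<in>S - {1}. (t choose 2) * (if even k then max_degree G else 1))"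
      by (rule prod.cong) (auto simp: n_def)
    also have "\<dots> = (t choose 2) ^ card (S - {1}) * max_degree G ^ card {k\<in>S - {1}. even k}"
      using S by (intro prod_if_even) auto
    \<comment> \<open>The number 1 is odd, so removing it leaves the even members of
      \<open>S\<close>, and thus \<open>q\<close>, unchanged.\<close>
    also have "{k\<in>S - {1}. even k} = {k\<in>S. even k}" by auto
    finally show ?thesis using assms(8) by simp
  qed
  show ?thesis
  proof (intro conjI impI)
    assume "1 \<notin> S"
    then show "chromatic_number (exact_distances_graph G S)
        \<le> (t choose 2) ^ s * max_degree G ^ q * (p + 1)"
      using bound rest assms(7) by simp
  next
    assume "1 \<in> S"
    then have "(\<Prod>k\<in>S. n k) = t * (\<Prod>k\<in>S - {1}. n k)" "card (S - {1}) = s - 1"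
      using prod.remove[OF S, of 1 n] S assms(7) by (auto simp: n_def)
    then show "chromatic_number (exact_distances_graph G S)
        \<le> t * (t choose 2) ^ (s - 1) * max_degree G ^ q * (p + 1)"
      using bound rest by (simp add: mult.assoc)
  qed
qed

end
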